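(* Let $\alpha\in(0,1)$, $\sigma=1-\alpha/2$, and let $\Omega\subset\mathbb R^d$ be a bounded Lipschitz domain. Let $f\in L^\infty([0,\infty);L^2(\Omega))\cap BV([0,\infty);L^2(\Omega))$ and $u^0\in H_0^1(\Omega)$. Let $0=t_0<t_1<\cdots$ be a time mesh with $\tau_j=t_j-t_{j-1}$, $\rho_j=\tau_j/\tau_{j-1}$, such that for every $k\ge2$: $\rho_k>\rho_*$, $\rho_{k+1}>\rho_*$, and if $\rho_k<\eta$ then $\rho_{k+1}\le \rho_k^2(1+\rho_k)/(1-3\rho_k^2(1+\rho_k))$ (for example, $\rho_k\ge\eta$ for all $k\ge2$). Let $u^k\in H_0^1(\Omega)$, $k\ge1$, be the solution of the L2-1$_\sigma$ scheme $$L_k^{\alpha,*}u=(1-\alpha/2)\Delta u^k+(\alpha/2)\Delta u^{k-1}+f^k\ \text{in }\Omega,\qquad u^k=0\ \text{on }\partial\Omega,\qquad k\ge1,$$ where $f^k=f(t_k^*,\cdot)$. Then there are a constant $C_f$ depending only on $f$ and a constant $C_\Omega$ (the Sobolev embedding constant, depending only on $\Omega$ and $d$) such that for all $n\ge1$, $$\|\nabla u^n\|_{L^2(\Omega)}\le\|\nabla u^0\|_{L^2(\Omega)}+2C_fC_\Omega .$$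
   Context: Notation: $t_k^*=t_{k-1}+\sigma\tau_k$. For $k\ge2$ and $1\le j\le k-1$ define $$a_j^k=\int_0^1\frac{-2\tau_j(1-\theta)-\tau_{j+1}}{(\tau_j+\tau_{j+1})\,(t_k^*-t_{j-1}-\theta\tau_j)^\alpha}\,\mathrm d\theta,\qquad c_j^k=\int_0^1\frac{\tau_j^2(2\theta-1)}{\tau_{j+1}(\tau_j+\tau_{j+1})\,(t_k^*-t_{j-1}-\theta\tau_j)^\alpha}\,\mathrm d\theta,$$ and $d_j^k=c_{j-1}^k-a_j^k$ for $2\le j\le k-1$; by convention $a_1^1=0$, $c_0^1=0$. With $\delta_j u=u^j-u^{j-1}$, $$L_k^{\alpha,*}u=\frac{1}{\Gamma(1-\alpha)}\Big(c_{k-1}^k\delta_k u-a_1^k\delta_1u+\sum_{j=2}^{k-1}d_j^k\delta_j u\Big)+\frac{\sigma^{1-\alpha}}{\Gamma(2-\alpha)\tau_k^\alpha}\delta_k u.$$ $\rho_*\approx 0.356341$ is the unique positive root of $\rho(1+\rho)=1-3\rho^2(1+\rho)$, and $\eta\approx0.475329$ is the unique positive root of $1-3\rho^2(1+\rho)=0$. The scheme is understood in the weak ($H_0^1$) sense. *)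

theory Defs
  imports "HOL-Analysis.Analysis"
begin

definition pderiv_dir :: "'a::euclidean_space \<Rightarrow> ('a \<Rightarrow> real) \<Rightarrow> 'a \<Rightarrow> real" where
  "pderiv_dir i \<phi> x = frechet_derivative \<phi> (at x) i"

fun iter_pderiv :: "'a::euclidean_space list \<Rightarrow> ('a \<Rightarrow> real) \<Rightarrow> 'a \<Rightarrow> real" where
  "iter_pderiv [] \<phi> = \<phi>"
| "iter_pderiv (i # is) \<phi> = pderiv_dir i (iter_pderiv is \<phi>)"

definition smooth_fun :: "('a::euclidean_space \<Rightarrow> real) \<Rightarrow> bool" where
  "smooth_fun \<phi> \<longleftrightarrow> (\<forall>is. set is \<subseteq> Basis \<longrightarrow> (\<forall>x. iter_pderiv is \<phi> differentiable (at x)))"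

definition test_fun :: "'a::euclidean_space set \<Rightarrow> ('a \<Rightarrow> real) \<Rightarrow> bool" where
  "test_fun \<Omega> \<phi> \<longleftrightarrow> smooth_fun \<phi> \<and> compact (closure {x. \<phi> x \<noteq> 0})
      \<and> closure {x. \<phi> x \<noteq> 0} \<subseteq> \<Omega>"

definition cgrad :: "('a::euclidean_space \<Rightarrow> real) \<Rightarrow> 'a \<Rightarrow> 'a" where
  "cgrad \<phi> x = (\<Sum>i\<in>Basis. pderiv_dir i \<phi> x *\<^sub>R i)"

definition L2 :: "'a::euclidean_space set \<Rightarrow> ('a \<Rightarrow> real) \<Rightarrow> bool" where
  "L2 \<Omega> u \<longleftrightarrow> u \<in> borel_measurable (lebesgue_on \<Omega>)
      \<and> integrable (lebesgue_on \<Omega>) (\<lambda>x. (u x)\<^sup>2)"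

definition L2norm :: "'a::euclidean_space set \<Rightarrow> ('a \<Rightarrow> real) \<Rightarrow> real" where
  "L2norm \<Omega> u = sqrt (integral\<^sup>L (lebesgue_on \<Omega>) (\<lambda>x. (u x)\<^sup>2))"

definition L2vec :: "'a::euclidean_space set \<Rightarrow> ('a \<Rightarrow> 'a) \<Rightarrow> bool" where
  "L2vec \<Omega> g \<longleftrightarrow> g \<in> borel_measurable (lebesgue_on \<Omega>)
      \<and> integrable (lebesgue_on \<Omega>) (\<lambda>x. (norm (g x))\<^sup>2)"

definition L2vec_norm :: "'a::euclidean_space set \<Rightarrow> ('a \<Rightarrow> 'a) \<Rightarrow> real" where
  "L2vec_norm \<Omega> g = sqrt (integral\<^sup>L (lebesgue_on \<Omega>) (\<lambda>x. (norm (g x))\<^sup>2))"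

definition weak_grad :: "'a::euclidean_space set \<Rightarrow> ('a \<Rightarrow> real) \<Rightarrow> ('a \<Rightarrow> 'a) \<Rightarrow> bool" where
  "weak_grad \<Omega> u g \<longleftrightarrow> g \<in> borel_measurable (lebesgue_on \<Omega>) \<and>
     (\<forall>\<phi> i. test_fun \<Omega> \<phi> \<longrightarrow> i \<in> Basis \<longrightarrow>
        integrable (lebesgue_on \<Omega>) (\<lambda>x. u x * pderiv_dir i \<phi> x) \<and>
        integrable (lebesgue_on \<Omega>) (\<lambda>x. (g x \<bullet> i) * \<phi> x) \<and>
        integral\<^sup>L (lebesgue_on \<Omega>) (\<lambda>x. u x * pderiv_dir i \<phi> x)
          = - integral\<^sup>L (lebesgue_on \<Omega>) (\<lambda>x. (g x \<bullet> i) * \<phi> x))"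

definition H1 :: "'a::euclidean_space set \<Rightarrow> ('a \<Rightarrow> real) \<Rightarrow> bool" where
  "H1 \<Omega> u \<longleftrightarrow> L2 \<Omega> u \<and> (\<exists>g. weak_grad \<Omega> u g \<and> L2vec \<Omega> g)"

definition H01 :: "'a::euclidean_space set \<Rightarrow> ('a \<Rightarrow> real) \<Rightarrow> bool" where
  "H01 \<Omega> u \<longleftrightarrow> (\<exists>g. L2 \<Omega> u \<and> weak_grad \<Omega> u g \<and> L2vec \<Omega> g \<and>
     (\<exists>\<phi>::nat \<Rightarrow> 'a \<Rightarrow> real. (\<forall>n. test_fun \<Omega> (\<phi> n)) \<and>
        (\<lambda>n. L2norm \<Omega> (\<lambda>x. \<phi> n x - u x)) \<longlonglongrightarrow> 0 \<and>
        (\<lambda>n. L2vec_norm \<Omega> (\<lambda>x. cgrad (\<phi> n) x - g x)) \<longlonglongrightarrow> 0))"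

definition lipschitz_domain :: "'a::euclidean_space set \<Rightarrow> bool" where
  "lipschitz_domain \<Omega> \<longleftrightarrow> open \<Omega> \<and> connected \<Omega> \<and> \<Omega> \<noteq> {} \<and>
     (\<forall>x\<in>frontier \<Omega>. \<exists>r>0. \<exists>e. norm e = 1 \<and> (\<exists>L \<gamma>.
        L-lipschitz_on {z. z \<bullet> e = 0} \<gamma> \<and>
        \<Omega> \<inter> ball x r = {y \<in> ball x r. y \<bullet> e > \<gamma> (y - (y \<bullet> e) *\<^sub>R e)}))"

definition bounded_lipschitz_domain :: "'a::euclidean_space set \<Rightarrow> bool" where
  "bounded_lipschitz_domain \<Omega> \<longleftrightarrow> bounded \<Omega> \<and> lipschitz_domain \<Omega>"

definition source_ok :: "'a::euclidean_space set \<Rightarrow> (real \<Rightarrow> 'a \<Rightarrow> real) \<Rightarrow> bool" where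
  "source_ok \<Omega> f \<longleftrightarrow> (\<forall>t\<ge>0. L2 \<Omega> (f t)) \<and>
     (\<exists>M. \<forall>t\<ge>0. L2norm \<Omega> (f t) \<le> M) \<and>
     (\<exists>V. \<forall>m (s::nat \<Rightarrow> real). s 0 \<ge> 0 \<longrightarrow> (\<forall>i<m. s i \<le> s (Suc i)) \<longrightarrow>
        (\<Sum>i<m. L2norm \<Omega> (\<lambda>x. f (s (Suc i)) x - f (s i) x)) \<le> V)"

definition rho_star :: real where
  "rho_star = (THE r. r > 0 \<and> r * (1 + r) = 1 - 3 * r\<^sup>2 * (1 + r))"

definition eta :: real where
  "eta = (THE r. r > 0 \<and> 1 - 3 * r\<^sup>2 * (1 + r) = 0)"

definition tau :: "(nat \<Rightarrow> real) \<Rightarrow> nat \<Rightarrow> real" where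
  "tau t j = t j - t (j - 1)"

definition rho :: "(nat \<Rightarrow> real) \<Rightarrow> nat \<Rightarrow> real" where
  "rho t j = tau t j / tau t (j - 1)"

definition mesh_ok :: "(nat \<Rightarrow> real) \<Rightarrow> bool" where
  "mesh_ok t \<longleftrightarrow> t 0 = 0 \<and> strict_mono t \<and>
     (\<forall>k\<ge>2. rho t k > rho_star \<and> rho t (k + 1) > rho_star \<and>
        (rho t k < eta \<longrightarrow>
          rho t (k + 1) \<le> (rho t k)\<^sup>2 * (1 + rho t k) / (1 - 3 * (rho t k)\<^sup>2 * (1 + rho t k))))"

definition tstar :: "real \<Rightarrow> (nat \<Rightarrow> real) \<Rightarrow> nat \<Rightarrow> real" where
  "tstar \<sigma> t k = t (k - 1) + \<sigma> * tau t k"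

definition acoef :: "real \<Rightarrow> real \<Rightarrow> (nat \<Rightarrow> real) \<Rightarrow> nat \<Rightarrow> nat \<Rightarrow> real" where
  "acoef \<alpha> \<sigma> t k j = (if k = 1 then 0 else
     integral {0..1} (\<lambda>\<theta>. (- 2 * tau t j * (1 - \<theta>) - tau t (j + 1)) /
        ((tau t j + tau t (j + 1)) * (tstar \<sigma> t k - t (j - 1) - \<theta> * tau t j) powr \<alpha>)))"

definition ccoef :: "real \<Rightarrow> real \<Rightarrow> (nat \<Rightarrow> real) \<Rightarrow> nat \<Rightarrow> nat \<Rightarrow> real" where
  "ccoef \<alpha> \<sigma> t k j = (if k = 1 then 0 else
     integral {0..1} (\<lambda>\<theta>. ((tau t j)\<^sup>2 * (2 * \<theta> - 1)) /
        (tau t (j + 1) * (tau t j + tau t (j + 1)) * (tstar \<sigma> t k - t (j - 1) - \<theta> * tau t j) powr \<alpha>)))"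

definition dcoef :: "real \<Rightarrow> real \<Rightarrow> (nat \<Rightarrow> real) \<Rightarrow> nat \<Rightarrow> nat \<Rightarrow> real" where
  "dcoef \<alpha> \<sigma> t k j = ccoef \<alpha> \<sigma> t k (j - 1) - acoef \<alpha> \<sigma> t k j"

definition Lop :: "real \<Rightarrow> real \<Rightarrow> (nat \<Rightarrow> real) \<Rightarrow> nat \<Rightarrow> (nat \<Rightarrow> 'a \<Rightarrow> real) \<Rightarrow> 'a \<Rightarrow> real" where
  "Lop \<alpha> \<sigma> t k u x =
     (1 / Gamma (1 - \<alpha>)) *
       (ccoef \<alpha> \<sigma> t k (k - 1) * (u k x - u (k - 1) x)
        - acoef \<alpha> \<sigma> t k 1 * (u 1 x - u 0 x)
        + (\<Sum>j\<in>{2..k - 1}. dcoef \<alpha> \<sigma> t k j * (u j x - u (j - 1) x)))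
     + \<sigma> powr (1 - \<alpha>) / (Gamma (2 - \<alpha>) * tau t k powr \<alpha>) * (u k x - u (k - 1) x)"

definition L21sigma_solution ::
  "'a::euclidean_space set \<Rightarrow> real \<Rightarrow> (real \<Rightarrow> 'a \<Rightarrow> real) \<Rightarrow> (nat \<Rightarrow> real)
     \<Rightarrow> (nat \<Rightarrow> 'a \<Rightarrow> real) \<Rightarrow> (nat \<Rightarrow> 'a \<Rightarrow> 'a) \<Rightarrow> bool" where
  "L21sigma_solution \<Omega> \<alpha> f t u G \<longleftrightarrow>
     (\<forall>k. H01 \<Omega> (u k) \<and> weak_grad \<Omega> (u k) (G k) \<and> L2vec \<Omega> (G k)) \<and>
     (\<forall>k\<ge>1. \<forall>v Gv. H01 \<Omega> v \<longrightarrow> weak_grad \<Omega> v Gv \<longrightarrow> L2vec \<Omega> Gv \<longrightarrow>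
        integral\<^sup>L (lebesgue_on \<Omega>) (\<lambda>x. Lop \<alpha> (1 - \<alpha> / 2) t k u x * v x)
        + (1 - \<alpha> / 2) * integral\<^sup>L (lebesgue_on \<Omega>) (\<lambda>x. G k x \<bullet> Gv x)
        + (\<alpha> / 2) * integral\<^sup>L (lebesgue_on \<Omega>) (\<lambda>x. G (k - 1) x \<bullet> Gv x)
        = integral\<^sup>L (lebesgue_on \<Omega>) (\<lambda>x. f (tstar (1 - \<alpha> / 2) t k) x * v x))"

end

theory Submission
  imports Defs
begin

text \<open>Testing the scheme with \<open>\<delta>\<^sub>k u\<close> and summing over \<open>k\<close> gives the energy estimate as soon as the
  quadratic form \<open>\<Sum>\<^sub>k (L\<^sub>k u) \<delta>\<^sub>k u\<close> is nonnegative; the source term is summed by parts in time and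
  bounded by the Poincare inequality, at the index where the gradient norm is largest.

  The form is a lower triangular kernel \<open>A k j\<close>, and it is nonnegative when the increments
  \<open>A k j - A k (j - 1)\<close> are nonnegative and nonincreasing in \<open>k\<close>. Each increment is a linear functional
  of the function \<open>s \<mapsto> (T - s)\<^sup>-\<^sup>\<alpha>\<close> with \<open>T = t\<^sub>k\<^sup>*\<close>, so both properties follow from one fact:
  the functional is nonnegative on nondecreasing convex functions, and both \<open>(T - s)\<^sup>-\<^sup>\<alpha>\<close> and
  \<open>(T - s)\<^sup>-\<^sup>\<alpha> - (T' - s)\<^sup>-\<^sup>\<alpha>\<close> for \<open>T \<le> T'\<close> are of this kind. The diagonal needs only
  \<open>2\<sigma> - (1 - \<alpha>) = 1\<close> and the subadditivity of \<open>x \<mapsto> x\<^sup>1\<^sup>-\<^sup>\<alpha>\<close>.\<close>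

subsection \<open>Nonnegativity of monotone triangular forms\<close>

text \<open>The obstacle is that a row increment \<open>d_j - d_(j-1)\<close> contains
  \<open>- c_(j-2)\<close>, a moment over one cell that only quantities on the next cell can absorb.
  Convexity supplies a single slope \<open>\<kappa>\<close> at their common end point, an upper
  bound for the slopes on the left cell and a lower bound on the right one. On a cell of length
  \<open>h\<close>, a line of slope \<open>\<kappa>\<close> has moment
  \<open>\<kappa> * h / 6\<close>, and its mean lies \<open>\<kappa> * h / 2\<close> below its right
  end value; the quotient of these two constants is the 3 of the mesh condition. Row
  \<open>k\<close> can be compared in this way only up to \<open>t (k - 1)\<close>, since
  \<open>t\<^sub>k\<^sup>*\<close> lies inside cell \<open>k\<close>, where the kernel is singular.
  This is why the diagonal, with its local term, needs a separate estimate. The form is nonnegative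
  for each point \<open>x\<close> separately and is then integrated. The source is linear, the
  energy quadratic, in the largest gradient norm, so at the maximal index one factor cancels. The
  constants obtained are \<open>2 * R\<close>, where \<open>\<Omega>\<close> lies in the ball of
  radius \<open>R\<close>, and \<open>2 * B + V\<close>, with \<open>B\<close> a bound and
  \<open>V\<close> a variation bound of \<open>f\<close>; neither involves \<alpha> or the
  mesh.\<close>

text \<open>Abel summation by induction on \<open>n\<close>: the new value \<open>x (Suc n)\<close>
  joins every tail, and its coefficients telescope to \<open>A (Suc n)\<close> because
  \<open>A 0 = 0\<close>.\<close>

lemma sum_by_parts_tails:
  fixes A x :: "nat \<Rightarrow> real"
  assumes "A 0 = 0"
  shows "(\<Sum>j=1..n. (A j - A (j - 1)) * (\<Sum>i=j..n. x i)) = (\<Sum>j=1..n. A j * x j)"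
proof (induction n)
  case 0
  then show ?case by simp
next
  case (Suc n)
  have tele: "(\<Sum>j=1..m. A j - A (j - 1)) = A m" for m
    using assms by (induction m) auto
  have "(\<Sum>j=1..Suc n. (A j - A (j - 1)) * (\<Sum>i=j..Suc n. x i))
      = (\<Sum>j=1..Suc n. (A j - A (j - 1)) * (\<Sum>i=j..n. x i)
          + (A j - A (j - 1)) * x (Suc n))"
    by (intro sum.cong refl) (auto simp: algebra_simps)
  also have "\<dots> = (\<Sum>j=1..n. (A j - A (j - 1)) * (\<Sum>i=j..n. x i)) + A (Suc n) * x (Suc n)"
    unfolding sum.distrib sum_distrib_right[symmetric] tele by simp
  finally show ?case using Suc by simp
qed

text \<open>In terms of the tails \<open>X k j = x j + \<dots> + x k\<close> the form dominates a weighted sum of squares,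
  since \<open>x k * X k j\<close> is half the increment of \<open>(X k j)\<^sup>2\<close> plus \<open>(x k)\<^sup>2 / 2\<close>.\<close>
lemma monotone_kernel_form_nonneg:
  fixes A :: "nat \<Rightarrow> nat \<Rightarrow> real" and x :: "nat \<Rightarrow> real"
  assumes zero: "\<And>k. A k 0 = 0"
    and row: "\<And>k j. 1 \<le> j \<Longrightarrow> j \<le> k \<Longrightarrow> A k (j - 1) \<le> A k j"
    and col: "\<And>k j. 1 \<le> j \<Longrightarrow> j \<le> k \<Longrightarrow>
                A (Suc k) j - A (Suc k) (j - 1) \<le> A k j - A k (j - 1)"
  shows "0 \<le> (\<Sum>k=1..n. x k * ((\<Sum>j=1..<k. A k j * x j) + A k k / 2 * x k))"
proof -
  define W where "W k j = A k j - A k (j - 1)" for k j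
  define X where "X k j = (\<Sum>i=j..k. x i)" for k j :: nat
  define E where "E k = (\<Sum>j=1..k. W k j * (X k j)\<^sup>2) / 2" for k
  have E_nonneg: "0 \<le> E k" for k
    unfolding E_def W_def by (intro divide_nonneg_nonneg sum_nonneg mult_nonneg_nonneg) (use row in auto)
  \<comment> \<open>The energy \<open>E\<close> of the tails is a lower bound that can be carried
    through the induction, unlike bare nonnegativity: passing to row \<open>n + 1\<close> adds
    exactly the new energy minus the old squares taken with the new weights, and \<open>col\<close>
    says that these weights did not grow.\<close>
  have "E n \<le> (\<Sum>k=1..n. x k * ((\<Sum>j=1..<k. A k j * x j) + A k k / 2 * x k))"
  proof (induction n)
    case 0
    then show ?case by (simp add: E_def)
  next
    case (Suc n)
    let ?N = "Suc n"
    have abel: "(\<Sum>j=1..?N. W ?N j * X ?N j) = (\<Sum>j=1..?N. A ?N j * x j)"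
      unfolding W_def X_def by (rule sum_by_parts_tails) (rule zero)
    have tot: "(\<Sum>j=1..?N. W ?N j) = A ?N ?N"
    proof -
      have "(\<Sum>j=1..m. W ?N j) = A ?N m" for m
        by (induction m) (auto simp: W_def zero)
      then show ?thesis .
    qed
    have Xn: "X ?N j = X n j + x ?N" if "j \<le> ?N" for j
      using that by (simp add: X_def)
    have "(\<Sum>j=1..?N. A ?N j * x j) = (\<Sum>j=1..<?N. A ?N j * x j) + A ?N ?N * x ?N"
      by (simp add: atLeastLessThanSuc_atLeastAtMost)
    then have "x ?N * ((\<Sum>j=1..<?N. A ?N j * x j) + A ?N ?N / 2 * x ?N)
        = x ?N * ((\<Sum>j=1..?N. W ?N j * X ?N j) - (\<Sum>j=1..?N. W ?N j) / 2 * x ?N)"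
      unfolding abel tot by (simp add: algebra_simps)
    also have "\<dots> = (\<Sum>j=1..?N. W ?N j * (x ?N * X ?N j - (x ?N)\<^sup>2 / 2))"
      by (simp only: right_diff_distrib sum_subtractf sum_distrib_left sum_distrib_right sum_divide_distrib)
         (simp add: power2_eq_square mult_ac)
    also have "\<dots> = (\<Sum>j=1..?N. W ?N j * (X ?N j)\<^sup>2 / 2 - W ?N j * (X n j)\<^sup>2 / 2)"
      by (intro sum.cong refl) (auto simp: Xn power2_eq_square field_simps)
    also have "\<dots> = E ?N - (\<Sum>j=1..?N. W ?N j * (X n j)\<^sup>2) / 2"
      by (simp only: sum_subtractf E_def sum_divide_distrib)
    \<comment> \<open>The term \<open>j = Suc n\<close> vanishes because \<open>X n (Suc n)\<close>
      is an empty sum.\<close>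
    also have "(\<Sum>j=1..?N. W ?N j * (X n j)\<^sup>2) = (\<Sum>j=1..n. W ?N j * (X n j)\<^sup>2)"
      by (simp add: X_def)
    finally have inc: "x ?N * ((\<Sum>j=1..<?N. A ?N j * x j) + A ?N ?N / 2 * x ?N)
        = E ?N - (\<Sum>j=1..n. W ?N j * (X n j)\<^sup>2) / 2" .
    have "(\<Sum>j=1..n. W ?N j * (X n j)\<^sup>2) \<le> (\<Sum>j=1..n. W n j * (X n j)\<^sup>2)"
      by (intro sum_mono mult_right_mono) (use col in \<open>auto simp: W_def\<close>)
    then have "E ?N - E n \<le> x ?N * ((\<Sum>j=1..<?N. A ?N j * x j) + A ?N ?N / 2 * x ?N)"
      unfolding inc E_def by simp
    then show ?case using Suc by simp
  qed
  then show ?thesis using E_nonneg[of n] by linarith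
qed

subsection \<open>Cell averages of convex nondecreasing functions\<close>

definition cell_mean :: "(real \<Rightarrow> real) \<Rightarrow> real \<Rightarrow> real \<Rightarrow> real" where
  "cell_mean g a h = integral {0..1} (\<lambda>\<theta>. g (a + \<theta> * h))"

text \<open>The weight \<open>2 * \<theta> - 1\<close> has mean zero, so the moment sees only the
  variation of \<open>g\<close> over the cell. It arises from writing the weight of
  \<open>a_j\<close> as \<open>2 * tau_j * (1 - \<theta>) + tau_(j+1) = (tau_j + tau_(j+1)) - tau_j
  * (2 * \<theta> - 1)\<close>, a mean minus a moment.\<close>

definition cell_moment :: "(real \<Rightarrow> real) \<Rightarrow> real \<Rightarrow> real \<Rightarrow> real" where
  "cell_moment g a h = integral {0..1} (\<lambda>\<theta>. (2 * \<theta> - 1) * g (a + \<theta> * h))"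

lemma moment_linear:
  fixes c d :: real
  shows "((\<lambda>\<theta>. (2 * \<theta> - 1) * (c + d * \<theta>)) has_integral (d / 6)) {0..1}"
proof -
  let ?P = "\<lambda>\<theta>::real. c * (\<theta>\<^sup>2 - \<theta>) + d * (2 / 3 * \<theta> ^ 3 - \<theta>\<^sup>2 / 2)"
  have "((\<lambda>\<theta>. (2 * \<theta> - 1) * (c + d * \<theta>)) has_integral (?P 1 - ?P 0)) {0..1}"
    by (intro fundamental_theorem_of_calculus)
       (auto intro!: derivative_eq_intros
         simp flip: has_real_derivative_iff_has_vector_derivative simp: algebra_simps power2_eq_square)
  moreover have "?P 1 - ?P 0 = d / 6" by simp
  ultimately show ?thesis by simp
qed

lemma mean_linear:
  fixes c d :: real
  shows "((\<lambda>\<theta>. c + d * \<theta>) has_integral (c + d / 2)) {0..1}"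
proof -
  let ?P = "\<lambda>\<theta>::real. c * \<theta> + d * \<theta>\<^sup>2 / 2"
  have "((\<lambda>\<theta>. c + d * \<theta>) has_integral (?P 1 - ?P 0)) {0..1}"
    by (intro fundamental_theorem_of_calculus)
       (auto intro!: derivative_eq_intros
         simp flip: has_real_derivative_iff_has_vector_derivative simp: algebra_simps power2_eq_square)
  then show ?thesis by simp
qed

text \<open>Replacing \<open>\<phi>\<close> by its midpoint value does not increase the integrand on
  either half of the interval, and the moment of a constant is zero.\<close>

lemma moment_mono_nonneg:
  fixes \<phi> :: "real \<Rightarrow> real"
  assumes "continuous_on {0..1} \<phi>" and mono: "\<And>x y. 0 \<le> x \<Longrightarrow> x \<le> y \<Longrightarrow> y \<le> 1 \<Longrightarrow> \<phi> x \<le> \<phi> y"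
  shows "0 \<le> integral {0..1} (\<lambda>\<theta>. (2 * \<theta> - 1) * \<phi> \<theta>)"
proof -
  have "((\<lambda>\<theta>::real. (2 * \<theta> - 1) * (\<phi> (1/2) + 0 * \<theta>)) has_integral (0 / 6)) {0..1}"
    by (rule moment_linear)
  moreover have "(\<lambda>\<theta>. (2 * \<theta> - 1) * \<phi> \<theta>) integrable_on {0..1}"
    by (intro integrable_continuous_interval continuous_intros assms)
  ultimately show ?thesis
  proof (intro has_integral_le[of "\<lambda>\<theta>::real. (2 * \<theta> - 1) * (\<phi> (1/2) + 0 * \<theta>)" 0 "{0..1}" "\<lambda>\<theta>. (2 * \<theta> - 1) * \<phi> \<theta>"])
    fix \<theta> :: real assume "\<theta> \<in> {0..1}"
    then show "(2 * \<theta> - 1) * (\<phi> (1/2) + 0 * \<theta>) \<le> (2 * \<theta> - 1) * \<phi> \<theta>"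
      using mono[of \<theta> "1/2"] mono[of "1/2" \<theta>]
      by (cases "\<theta> \<le> 1/2") (auto intro: mult_left_mono mult_left_mono_neg)
  qed (auto simp: integrable_integral)
qed

text \<open>Convexity is expressed through an explicit monotone derivative, so that slopes can be
  compared across cells. The half-line up to \<open>b\<close> covers all cells ending at or before
  \<open>b\<close>; the derivative at \<open>b\<close> is two-sided, which for a kernel with
  singularity \<open>T\<close> is ensured by \<open>b < T\<close>.\<close>

definition convex_incr :: "(real \<Rightarrow> real) \<Rightarrow> (real \<Rightarrow> real) \<Rightarrow> real \<Rightarrow> bool" where
  "convex_incr g g' b \<longleftrightarrow> (\<forall>s\<le>b. (g has_real_derivative g' s) (at s) \<and> 0 \<le> g' s)
     \<and> (\<forall>s s'. s \<le> s' \<and> s' \<le> b \<longrightarrow> g' s \<le> g' s')"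

lemma convex_incr_le: "convex_incr g g' b \<Longrightarrow> c \<le> b \<Longrightarrow> convex_incr g g' c"
  unfolding convex_incr_def by auto

lemma convex_incr_slope_mono: "convex_incr g g' b \<Longrightarrow> s \<le> s' \<Longrightarrow> s' \<le> b \<Longrightarrow> g' s \<le> g' s'"
  unfolding convex_incr_def by blast

lemma convex_incr_slope_nonneg: "convex_incr g g' b \<Longrightarrow> s \<le> b \<Longrightarrow> 0 \<le> g' s"
  unfolding convex_incr_def by blast

text \<open>On the cell rescaled to the unit interval, subtracting the line of slope
  \<open>\<kappa>\<close> leaves a function with derivative \<open>(g' - \<kappa>) * h\<close>,
  which has a fixed sign.\<close>

lemma slope_mono:
  assumes g: "convex_incr g g' b" and ab: "a + h \<le> b" and h: "0 < h"
    and xy: "0 \<le> x" "x \<le> y" "y \<le> 1"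
  shows slope_ge: "(\<And>s. a \<le> s \<Longrightarrow> s \<le> a + h \<Longrightarrow> \<kappa> \<le> g' s) \<Longrightarrow>
            g (a + x * h) - \<kappa> * h * x \<le> g (a + y * h) - \<kappa> * h * y"
    and slope_le: "(\<And>s. a \<le> s \<Longrightarrow> s \<le> a + h \<Longrightarrow> g' s \<le> \<kappa>) \<Longrightarrow>
            g (a + y * h) - \<kappa> * h * y \<le> g (a + x * h) - \<kappa> * h * x"
proof -
  have in_range: "a \<le> a + z * h \<and> a + z * h \<le> a + h \<and> a + z * h \<le> b" if "0 \<le> z" "z \<le> 1" for z
  proof -
    have "0 \<le> z * h" "z * h \<le> 1 * h" using that h by (simp_all add: mult_right_mono)
    then show ?thesis using ab by linarith
  qed
  have deriv: "((\<lambda>z. g (a + z * h) - \<kappa> * h * z) has_real_derivative (g' (a + z * h) - \<kappa>) * h) (at z)"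
    if "0 \<le> z" "z \<le> 1" for z \<kappa>
  proof -
    have "(g has_real_derivative g' (a + z * h)) (at (a + z * h))"
      using g in_range[OF that] by (auto simp: convex_incr_def)
    moreover have "((\<lambda>z. a + z * h) has_real_derivative h) (at z)"
      by (auto intro!: derivative_eq_intros)
    ultimately have "((\<lambda>z. g (a + z * h)) has_real_derivative g' (a + z * h) * h) (at z)"
      by (rule DERIV_chain2)
    moreover have "((\<lambda>z. \<kappa> * h * z) has_real_derivative \<kappa> * h) (at z)"
      by (auto intro!: derivative_eq_intros)
    ultimately show ?thesis
      using DERIV_diff by (fastforce simp: left_diff_distrib)
  qed
  show "g (a + x * h) - \<kappa> * h * x \<le> g (a + y * h) - \<kappa> * h * y"
    if \<kappa>: "\<And>s. a \<le> s \<Longrightarrow> s \<le> a + h \<Longrightarrow> \<kappa> \<le> g' s"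
  proof (rule DERIV_nonneg_imp_nondecreasing[OF xy(2)])
    fix z assume "x \<le> z" "z \<le> y"
    then have z: "0 \<le> z" "z \<le> 1" using xy by auto
    have "0 \<le> (g' (a + z * h) - \<kappa>) * h"
      using \<kappa>[of "a + z * h"] in_range[OF z] h by simp
    then show "\<exists>D. ((\<lambda>z. g (a + z * h) - \<kappa> * h * z) has_real_derivative D) (at z) \<and> 0 \<le> D"
      using deriv[OF z] by blast
  qed
  show "g (a + y * h) - \<kappa> * h * y \<le> g (a + x * h) - \<kappa> * h * x"
    if \<kappa>: "\<And>s. a \<le> s \<Longrightarrow> s \<le> a + h \<Longrightarrow> g' s \<le> \<kappa>"
  proof (rule DERIV_nonpos_imp_nonincreasing[OF xy(2)])
    fix z assume "x \<le> z" "z \<le> y"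
    then have z: "0 \<le> z" "z \<le> 1" using xy by auto
    have "(g' (a + z * h) - \<kappa>) * h \<le> 0"
      using \<kappa>[of "a + z * h"] in_range[OF z] h by (simp add: mult_nonpos_nonneg)
    then show "\<exists>D. ((\<lambda>z. g (a + z * h) - \<kappa> * h * z) has_real_derivative D) (at z) \<and> D \<le> 0"
      using deriv[OF z] by blast
  qed
qed

lemma convex_incr_continuous:
  assumes g: "convex_incr g g' b" and ab: "a + h \<le> b" and h: "0 < h"
  shows "continuous_on {0..1} (\<lambda>\<theta>. g (a + \<theta> * h))"
proof -
  have "continuous_on {..b} g"
    using g by (intro continuous_at_imp_continuous_on) (auto simp: convex_incr_def intro: DERIV_isCont)
  moreover have "(\<lambda>\<theta>. a + \<theta> * h) ` {0..1} \<subseteq> {..b}"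
  proof clarsimp
    fix z :: real assume "0 \<le> z" "z \<le> 1"
    then show "a + z * h \<le> b" using mult_right_mono[of z 1 h] ab h by linarith
  qed
  moreover have "continuous_on {0..1} (\<lambda>\<theta>. a + \<theta> * h)" by (intro continuous_intros)
  ultimately show ?thesis using continuous_on_compose2 by blast
qed

text \<open>For the moments, the remainder after removing the line of slope \<open>\<kappa>\<close>
  is monotone, and the line itself contributes \<open>\<kappa> * h / 6\<close>. For the mean,
  \<open>g\<close> lies below the line of slope \<open>\<kappa>\<close> through its right end value.
  For the last bound, \<open>1 - c * (2 * \<theta> - 1)\<close> is a nonnegative weight of total
  mass 1 and \<open>g\<close> is smallest at \<open>a\<close>.\<close>

lemma cell_bounds:
  assumes g: "convex_incr g g' b" and ab: "a + h \<le> b" and h: "0 < h"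
  shows moment_ge: "(\<And>s. a \<le> s \<Longrightarrow> s \<le> a + h \<Longrightarrow> \<kappa> \<le> g' s) \<Longrightarrow> \<kappa> * h / 6 \<le> cell_moment g a h"
    and moment_le: "(\<And>s. a \<le> s \<Longrightarrow> s \<le> a + h \<Longrightarrow> g' s \<le> \<kappa>) \<Longrightarrow> cell_moment g a h \<le> \<kappa> * h / 6"
    and mean_le: "(\<And>s. a \<le> s \<Longrightarrow> s \<le> a + h \<Longrightarrow> \<kappa> \<le> g' s) \<Longrightarrow>
        cell_mean g a h \<le> g (a + h) - \<kappa> * h / 2"
    and weighted_ge: "0 \<le> c \<Longrightarrow> c \<le> 1 \<Longrightarrow> g a \<le> cell_mean g a h - c * cell_moment g a h"
proof -
  note slope = slope_mono[OF g ab h]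
  note cont = convex_incr_continuous[OF g ab h]
  have int_g: "(\<lambda>\<theta>. g (a + \<theta> * h)) integrable_on {0..1}"
    and int_q: "(\<lambda>\<theta>. (2 * \<theta> - 1) * g (a + \<theta> * h)) integrable_on {0..1}"
    by (intro integrable_continuous_interval continuous_intros cont)+
  have lin: "(\<lambda>\<theta>. (2 * \<theta> - 1) * (0 + d * \<theta>)) integrable_on {0..1}"
            "integral {0..1} (\<lambda>\<theta>. (2 * \<theta> - 1) * (0 + d * \<theta>)) = d / 6" for d :: real
    using moment_linear[of 0 d] by (auto simp: has_integral_iff)
  have split: "integral {0..1} (\<lambda>\<theta>. (2 * \<theta> - 1) * (g (a + \<theta> * h) - d * \<theta>)) = cell_moment g a h - d / 6" for d
    using integral_diff[OF int_q lin(1)[of d]] lin(2)[of d]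
    by (simp add: cell_moment_def right_diff_distrib)
  have split': "integral {0..1} (\<lambda>\<theta>. (2 * \<theta> - 1) * (d * \<theta> - g (a + \<theta> * h))) = d / 6 - cell_moment g a h" for d
    using integral_diff[OF lin(1)[of d] int_q] lin(2)[of d]
    by (simp add: cell_moment_def right_diff_distrib)
  show "\<kappa> * h / 6 \<le> cell_moment g a h" if "\<And>s. a \<le> s \<Longrightarrow> s \<le> a + h \<Longrightarrow> \<kappa> \<le> g' s"
  proof -
    have "0 \<le> integral {0..1} (\<lambda>\<theta>. (2 * \<theta> - 1) * (g (a + \<theta> * h) - \<kappa> * h * \<theta>))"
      by (intro moment_mono_nonneg continuous_intros cont) (rule slope(1)[OF _ _ _ that])
    then show ?thesis using split[of "\<kappa> * h"] by simp
  qed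
  show "cell_moment g a h \<le> \<kappa> * h / 6" if "\<And>s. a \<le> s \<Longrightarrow> s \<le> a + h \<Longrightarrow> g' s \<le> \<kappa>"
  proof -
    have "0 \<le> integral {0..1} (\<lambda>\<theta>. (2 * \<theta> - 1) * (\<kappa> * h * \<theta> - g (a + \<theta> * h)))"
    proof (intro moment_mono_nonneg continuous_intros cont)
      fix x y :: real assume "0 \<le> x" "x \<le> y" "y \<le> 1"
      from slope(2)[OF this that]
      show "\<kappa> * h * x - g (a + x * h) \<le> \<kappa> * h * y - g (a + y * h)" by linarith
    qed
    then show ?thesis using split'[of "\<kappa> * h"] by simp
  qed
  show "cell_mean g a h \<le> g (a + h) - \<kappa> * h / 2" if "\<And>s. a \<le> s \<Longrightarrow> s \<le> a + h \<Longrightarrow> \<kappa> \<le> g' s"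
  proof -
    have "cell_mean g a h \<le> (g (a + h) - \<kappa> * h) + (\<kappa> * h) / 2"
      unfolding cell_mean_def
    proof (rule has_integral_le[OF integrable_integral[OF int_g] mean_linear])
      fix \<theta> :: real assume "\<theta> \<in> {0..1}"
      then show "g (a + \<theta> * h) \<le> g (a + h) - \<kappa> * h + \<kappa> * h * \<theta>"
        using slope(1)[OF _ _ _ that, of \<theta> 1] by simp
    qed
    then show ?thesis by (simp add: field_simps)
  qed
  show "g a \<le> cell_mean g a h - c * cell_moment g a h" if c: "0 \<le> c" "c \<le> 1"
  proof -
    have low: "g a \<le> g (a + \<theta> * h)" if "0 \<le> \<theta>" "\<theta> \<le> 1" for \<theta>
    proof -
      have "0 \<le> g' s" if "s \<le> a + h" for s
        using g ab that by (auto simp: convex_incr_def)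
      from slope(1)[OF _ that(1) that(2) this] show ?thesis by simp
    qed
    have A: "((\<lambda>\<theta>. g (a + \<theta> * h) - c * ((2 * \<theta> - 1) * g (a + \<theta> * h))) has_integral
            (cell_mean g a h - c * cell_moment g a h)) {0..1}"
      unfolding cell_mean_def cell_moment_def
      by (intro has_integral_diff has_integral_mult_right integrable_integral int_g int_q)
    \<comment> \<open>The constant \<open>g a\<close> times the weight
      \<open>1 - c * (2 * \<theta> - 1)\<close>, arranged as a linear function of
      \<open>\<theta>\<close>.\<close>
    have B: "((\<lambda>\<theta>. g a + c * g a + (- 2 * c * g a) * \<theta>) has_integral (g a + c * g a + (- 2 * c * g a) / 2)) {0..1}"
      by (rule mean_linear)
    have "g a + c * g a + (- 2 * c * g a) / 2 \<le> cell_mean g a h - c * cell_moment g a h"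
    proof (rule has_integral_le[OF B A])
      fix \<theta> :: real assume th: "\<theta> \<in> {0..1}"
      have "0 \<le> 1 - c * (2 * \<theta> - 1)"
        using th c mult_mono[of c 1 "2 * \<theta> - 1" 1] mult_left_mono[of "2 * \<theta> - 1" 1 c] by auto
      from mult_left_mono[OF low this] th
      show "g a + c * g a + - 2 * c * g a * \<theta> \<le> g (a + \<theta> * h) - c * ((2 * \<theta> - 1) * g (a + \<theta> * h))"
        by (auto simp: algebra_simps)
    qed
    then show ?thesis by simp
  qed
qed

lemma cell_mean_diff:
  assumes "convex_incr g g' b" "convex_incr h h' b" "a + l \<le> b" "0 < l"
  shows "cell_mean (\<lambda>s. g s - h s) a l = cell_mean g a l - cell_mean h a l"
  unfolding cell_mean_def
  by (intro integral_diff integrable_continuous_interval convex_incr_continuous[OF assms(1,3,4)]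
        convex_incr_continuous[OF assms(2,3,4)])

lemma cell_moment_diff:
  assumes "convex_incr g g' b" "convex_incr h h' b" "a + l \<le> b" "0 < l"
  shows "cell_moment (\<lambda>s. g s - h s) a l = cell_moment g a l - cell_moment h a l"
proof -
  have "(\<lambda>\<theta>. (2 * \<theta> - 1) * g (a + \<theta> * l)) integrable_on {0..1}"
       "(\<lambda>\<theta>. (2 * \<theta> - 1) * h (a + \<theta> * l)) integrable_on {0..1}"
    by (intro integrable_continuous_interval continuous_on_mult convex_incr_continuous[OF assms(1,3,4)]
          convex_incr_continuous[OF assms(2,3,4)] continuous_intros)+
  from integral_diff[OF this] show ?thesis
    by (simp add: cell_moment_def right_diff_distrib)
qed

subsection \<open>The fractional kernel\<close>

text \<open>Since \<open>p - 1\<close> is nonpositive, \<open>z powr p\<close> is at least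
  \<open>z * (x + y) powr (p - 1)\<close> for \<open>z \<le> x + y\<close>; adding this for
  \<open>z = x\<close> and \<open>z = y\<close> gives the claim.\<close>

lemma powr_subadd:
  fixes x y p :: real
  assumes "0 < x" "0 < y" "0 < p" "p \<le> 1"
  shows "(x + y) powr p \<le> x powr p + y powr p"
proof -
  have "z * (x + y) powr (p - 1) \<le> z powr p" if "0 < z" "z \<le> x + y" for z
  proof -
    have "(x + y) powr (p - 1) \<le> z powr (p - 1)"
      using that assms by (intro powr_mono2') auto
    then have "z * (x + y) powr (p - 1) \<le> z * z powr (p - 1)"
      using that by (intro mult_left_mono) auto
    then show ?thesis using that by (simp add: powr_mult_base)
  qed
  from this[of x] this[of y] have "(x + y) * (x + y) powr (p - 1) \<le> x powr p + y powr p"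
    using assms by (simp add: distrib_right)
  then show ?thesis using assms by (simp add: powr_mult_base)
qed

definition frac_kernel :: "real \<Rightarrow> real \<Rightarrow> real \<Rightarrow> real" where
  "frac_kernel \<alpha> T s = (T - s) powr (- \<alpha>)"

lemma powr_base_deriv:
  fixes T s p :: real
  assumes "s < T"
  shows "((\<lambda>s. (T - s) powr p) has_real_derivative - p * (T - s) powr (p - 1)) (at s)"
proof -
  have "((\<lambda>x. x powr p) has_real_derivative p * (T - s) powr (p - 1)) (at (T - s))"
    using assms by (intro has_real_derivative_powr) auto
  moreover have "((\<lambda>s. T - s) has_real_derivative - 1) (at s)"
    by (auto intro!: derivative_eq_intros)
  ultimately have "((\<lambda>s. (T - s) powr p) has_real_derivative p * (T - s) powr (p - 1) * (- 1)) (at s)"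
    by (rule DERIV_chain2)
  then show ?thesis by simp
qed

lemma convex_incr_kernel:
  assumes "0 < \<alpha>" "b < T"
  shows "convex_incr (frac_kernel \<alpha> T) (\<lambda>s. \<alpha> * (T - s) powr (- \<alpha> - 1)) b"
  unfolding convex_incr_def
proof (intro conjI allI impI)
  fix s s' assume s: "s \<le> s' \<and> s' \<le> b"
  show "\<alpha> * (T - s) powr (- \<alpha> - 1) \<le> \<alpha> * (T - s') powr (- \<alpha> - 1)"
    using s assms by (intro mult_left_mono powr_mono2') auto
next
  fix s assume "s \<le> b"
  then show "(frac_kernel \<alpha> T has_real_derivative \<alpha> * (T - s) powr (- \<alpha> - 1)) (at s)"
    using powr_base_deriv[of s T "- \<alpha>"] assms by (simp add: frac_kernel_def[abs_def])
qed (use assms in auto)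

text \<open>The first and second derivatives of the kernel in \<open>s\<close> decrease when
  \<open>T\<close> grows. Rows \<open>k\<close> and \<open>k + 1\<close> apply the same functional
  to kernels with different \<open>T\<close>, so this turns monotonicity in the row index into
  positivity of one functional.\<close>

lemma convex_incr_kernel_diff:
  assumes "0 < \<alpha>" "b < T" "T \<le> T'"
  shows "convex_incr (\<lambda>s. frac_kernel \<alpha> T s - frac_kernel \<alpha> T' s)
           (\<lambda>s. \<alpha> * (T - s) powr (- \<alpha> - 1) - \<alpha> * (T' - s) powr (- \<alpha> - 1)) b"
  unfolding convex_incr_def
proof (intro conjI allI impI)
  fix s assume s: "s \<le> b"
  show "((\<lambda>s. frac_kernel \<alpha> T s - frac_kernel \<alpha> T' s) has_real_derivative
      \<alpha> * (T - s) powr (- \<alpha> - 1) - \<alpha> * (T' - s) powr (- \<alpha> - 1)) (at s)"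
    using convex_incr_kernel[of \<alpha> b T] convex_incr_kernel[of \<alpha> b T'] assms s
    by (intro DERIV_diff) (auto simp: convex_incr_def)
  show "0 \<le> \<alpha> * (T - s) powr (- \<alpha> - 1) - \<alpha> * (T' - s) powr (- \<alpha> - 1)"
    using s assms by (auto intro!: mult_left_mono powr_mono2')
next
  fix s s' assume s: "s \<le> s' \<and> s' \<le> b"
  let ?f = "\<lambda>s. (T - s) powr (- \<alpha> - 1) - (T' - s) powr (- \<alpha> - 1)"
  have "?f s \<le> ?f s'"
  proof (rule DERIV_nonneg_imp_nondecreasing[where f = ?f])
    fix x assume x: "s \<le> x" "x \<le> s'"
    let ?D = "- (- \<alpha> - 1) * (T - x) powr (- \<alpha> - 1 - 1) - - (- \<alpha> - 1) * (T' - x) powr (- \<alpha> - 1 - 1)"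
    have "(?f has_real_derivative ?D) (at x)"
      using x s assms by (intro DERIV_diff powr_base_deriv) auto
    moreover have "(T' - x) powr (- \<alpha> - 1 - 1) \<le> (T - x) powr (- \<alpha> - 1 - 1)"
      using x s assms by (intro powr_mono2') auto
    then have "0 \<le> ?D" using mult_left_mono[of _ _ "\<alpha> + 1"] assms by force
    ultimately show "\<exists>y. (?f has_real_derivative y) (at x) \<and> 0 \<le> y" by blast
  qed (use s in auto)
  then have "\<alpha> * ?f s \<le> \<alpha> * ?f s'" using assms by (intro mult_left_mono) auto
  then show "\<alpha> * (T - s) powr (- \<alpha> - 1) - \<alpha> * (T' - s) powr (- \<alpha> - 1)
      \<le> \<alpha> * (T - s') powr (- \<alpha> - 1) - \<alpha> * (T' - s') powr (- \<alpha> - 1)"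
    by (simp add: right_diff_distrib)
qed

text \<open>The mean is an explicit difference of two powers with exponent
  \<open>1 - \<alpha>\<close>, and subadditivity removes its dependence on \<open>T\<close>.\<close>

lemma kernel_mean_le:
  assumes \<alpha>: "0 < \<alpha>" "\<alpha> < 1" and h: "0 < h" and T: "a + h < T"
  shows "cell_mean (frac_kernel \<alpha> T) a h \<le> h powr (- \<alpha>) / (1 - \<alpha>)"
proof -
  let ?P = "\<lambda>\<theta>. - ((T - (a + \<theta> * h)) powr (1 - \<alpha>)) / ((1 - \<alpha>) * h)"
  have "((\<lambda>\<theta>. frac_kernel \<alpha> T (a + \<theta> * h)) has_integral (?P 1 - ?P 0)) {0..1}"
  proof (rule fundamental_theorem_of_calculus)
    fix \<theta> :: real assume "\<theta> \<in> {0..1}"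
    then have "\<theta> * h \<le> 1 * h" using h by (intro mult_right_mono) auto
    then have lt: "a + \<theta> * h < T" using T by simp
    have "((\<lambda>\<theta>. a + \<theta> * h) has_real_derivative h) (at \<theta>)"
      by (auto intro!: derivative_eq_intros)
    from DERIV_chain2[OF powr_base_deriv[OF lt, of "1 - \<alpha>"] this]
    have "((\<lambda>\<theta>. (T - (a + \<theta> * h)) powr (1 - \<alpha>)) has_real_derivative
        - (1 - \<alpha>) * (T - (a + \<theta> * h)) powr (- \<alpha>) * h) (at \<theta>)" by simp
    from DERIV_cdivide[OF DERIV_minus[OF this], of "(1 - \<alpha>) * h"]
    have "(?P has_real_derivative frac_kernel \<alpha> T (a + \<theta> * h)) (at \<theta>)"
      by (rule DERIV_cong) (use \<alpha> h in \<open>simp add: frac_kernel_def divide_eq_eq algebra_simps\<close>)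
    then show "(?P has_vector_derivative frac_kernel \<alpha> T (a + \<theta> * h)) (at \<theta> within {0..1})"
      by (simp add: has_real_derivative_iff_has_vector_derivative has_vector_derivative_at_within)
  qed simp
  then have "cell_mean (frac_kernel \<alpha> T) a h = ((T - a) powr (1 - \<alpha>) - (T - a - h) powr (1 - \<alpha>)) / ((1 - \<alpha>) * h)"
    by (simp add: cell_mean_def integral_unique diff_divide_distrib algebra_simps)
  also have "\<dots> \<le> h powr (1 - \<alpha>) / ((1 - \<alpha>) * h)"
    using powr_subadd[of h "T - a - h" "1 - \<alpha>"] \<alpha> h T by (intro divide_right_mono) auto
  also have "\<dots> = h powr (- \<alpha>) / (1 - \<alpha>)"
  proof -
    have "h powr (1 - \<alpha>) = h * h powr (- \<alpha>)" using powr_mult_base[of h "- \<alpha>"] h by simp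
    then show ?thesis using h by simp
  qed
  finally show ?thesis .
qed

text \<open>With \<open>h = tau t k\<close>, the first term is the kernel of row \<open>k\<close> at
  \<open>t (k - 1)\<close>, the mean dominates the new entry of row \<open>k + 1\<close>, and the
  right side is twice the local term. Divided by \<open>h powr (- \<alpha>) / (1 - \<alpha>)\<close>
  and after \<open>kernel_mean_le\<close>, the claim is
  \<open>(1 - \<alpha>) * s + 1 \<le> (2 - \<alpha>) * s\<close> for \<open>s\<close> the power
  \<open>- \<alpha>\<close> of \<open>1 - \<alpha> / 2\<close>, that is
  \<open>1 \<le> s\<close>.\<close>

lemma diagonal_bound:
  assumes \<alpha>: "0 < \<alpha>" "\<alpha> < 1" and h: "0 < h" and T: "a + h < T"
  shows "((1 - \<alpha> / 2) * h) powr (- \<alpha>) + cell_mean (frac_kernel \<alpha> T) a h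
    \<le> 2 * ((1 - \<alpha> / 2) powr (1 - \<alpha>) / ((1 - \<alpha>) * h powr \<alpha>))"
proof -
  let ?\<sigma> = "1 - \<alpha> / 2"
  have \<sigma>: "0 < ?\<sigma>" "?\<sigma> \<le> 1" using \<alpha> by auto
  have "1 \<le> ?\<sigma> powr (- \<alpha>)" using powr_mono2'[of "- \<alpha>" ?\<sigma> 1] \<sigma> \<alpha> by simp
  moreover have "?\<sigma> powr (1 - \<alpha>) = ?\<sigma> * ?\<sigma> powr (- \<alpha>)"
    using powr_mult_base[of ?\<sigma> "- \<alpha>"] \<sigma> by simp
  ultimately have "(1 - \<alpha>) * ?\<sigma> powr (- \<alpha>) + 1 \<le> 2 * ?\<sigma> powr (1 - \<alpha>)"
    by (simp add: algebra_simps)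
  then have "((1 - \<alpha>) * ?\<sigma> powr (- \<alpha>) + 1) * (h powr (- \<alpha>) / (1 - \<alpha>))
      \<le> 2 * ?\<sigma> powr (1 - \<alpha>) * (h powr (- \<alpha>) / (1 - \<alpha>))"
    using \<alpha> by (intro mult_right_mono) auto
  moreover have "((1 - \<alpha>) * ?\<sigma> powr (- \<alpha>) + 1) * (h powr (- \<alpha>) / (1 - \<alpha>))
      = (?\<sigma> * h) powr (- \<alpha>) + h powr (- \<alpha>) / (1 - \<alpha>)"
    using \<alpha> unfolding powr_mult by (simp add: distrib_right add_divide_distrib)
  moreover have "2 * ?\<sigma> powr (1 - \<alpha>) * (h powr (- \<alpha>) / (1 - \<alpha>))
      = 2 * (?\<sigma> powr (1 - \<alpha>) / ((1 - \<alpha>) * h powr \<alpha>))"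
    by (simp add: powr_minus_divide)
  ultimately show ?thesis using kernel_mean_le[OF \<alpha> h T] by linarith
qed

subsection \<open>Coefficients of the scheme\<close>

text \<open>The polynomial is strictly increasing for nonnegative arguments and takes the value 1
  there, so the definite description in \<open>eta\<close> denotes its unique root.\<close>

lemma eta_props:
  shows eta_le: "eta \<le> r \<Longrightarrow> 1 \<le> 3 * r\<^sup>2 * (1 + r)"
    and less_eta: "0 \<le> r \<Longrightarrow> r < eta \<Longrightarrow> 3 * r\<^sup>2 * (1 + r) < 1"
proof -
  let ?p = "\<lambda>r::real. 3 * r\<^sup>2 * (1 + r)"
  have mono: "?p x < ?p y" if "0 \<le> x" "x < y" for x y
  proof -
    have "3 * x\<^sup>2 < 3 * y\<^sup>2" using that by (simp add: power_strict_mono)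
    moreover have "0 < y" using that by simp
    ultimately show ?thesis using that mult_strict_mono[of "3 * x\<^sup>2" "3 * y\<^sup>2" "1 + x" "1 + y"] by simp
  qed
  have "\<exists>r\<ge>0. r \<le> 1 \<and> ?p r = 1"
    by (intro IVT') (auto intro!: continuous_intros)
  then obtain r0 where r0: "0 \<le> r0" "?p r0 = 1" by blast
  then have "0 < r0" by (cases "r0 = 0") auto
  moreover have "x = r0" if "0 < x" "?p x = 1" for x
    using mono[of x r0] mono[of r0 x] that r0 by linarith
  moreover have root: "1 - ?p x = 0 \<longleftrightarrow> ?p x = 1" for x by auto
  ultimately have "eta = r0"
    unfolding eta_def root using r0(2) by (intro the_equality) blast+
  then show "1 \<le> ?p r" if "eta \<le> r"
    using mono[of r0 r] r0 that by (cases "r = r0") auto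
  show "?p r < 1" if "0 \<le> r" "r < eta"
    using mono[of r r0] r0 that \<open>eta = r0\<close> by simp
qed

lemma tau_pos: "mesh_ok t \<Longrightarrow> 1 \<le> j \<Longrightarrow> 0 < tau t j"
  unfolding mesh_ok_def tau_def by (auto simp: strict_mono_def)

lemma rho_pos: "mesh_ok t \<Longrightarrow> 2 \<le> j \<Longrightarrow> 0 < rho t j"
  unfolding rho_def by (intro divide_pos_pos tau_pos) auto

text \<open>The form in which the mesh condition is used. With
  \<open>P = r\<^sup>2 * (1 + r)\<close>, the bound \<open>s \<le> P / (1 - 3 * P)\<close> for
  \<open>r < eta\<close> rearranges to \<open>1 / P - 3 \<le> 1 / s\<close>; for \<open>r\<close> at
  least \<open>eta\<close> already \<open>1 / P \<le> 3\<close>.\<close>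

lemma mesh_ratio:
  assumes m: "mesh_ok t" and j: "2 \<le> j"
  shows "1 / ((rho t j)\<^sup>2 * (1 + rho t j)) \<le> 3 + 1 / rho t (j + 1)"
proof -
  let ?r = "rho t j" and ?s = "rho t (j + 1)"
  let ?P = "?r\<^sup>2 * (1 + ?r)"
  have r: "0 < ?r" "0 < ?s" using rho_pos[OF m] j by auto
  then have P: "0 < ?P" by (intro mult_pos_pos) auto
  show ?thesis
  proof (cases "?r < eta")
    case True
    then have "?s \<le> ?P / (1 - 3 * ?P)" using m j by (simp add: mesh_ok_def mult.assoc)
    moreover have "0 < 1 - 3 * ?P" using less_eta[of ?r] r True by (simp add: mult.assoc)
    ultimately have "?s * (1 - 3 * ?P) \<le> ?P" by (simp add: pos_le_divide_eq)
    then show ?thesis using r P by (simp add: field_simps)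
  next
    case False
    then have "1 \<le> 3 * ?P" using eta_le[of ?r] by (simp add: mult.assoc)
    then have "1 / ?P \<le> 3" using P by (simp add: pos_divide_le_eq)
    then show ?thesis using r by (simp add: add_increasing2)
  qed
qed

text \<open>The coefficients \<open>c\<^sub>j\<close>, \<open>- a\<^sub>j\<close> and \<open>d\<^sub>j\<close> with an arbitrary function \<open>g\<close> in place of the kernel.\<close>
definition cbar :: "(nat \<Rightarrow> real) \<Rightarrow> (real \<Rightarrow> real) \<Rightarrow> nat \<Rightarrow> real" where
  "cbar t g j = (if j = 0 then 0 else
     cell_moment g (t (j - 1)) (tau t j) / (rho t (j + 1) * (1 + rho t (j + 1))))"

definition abar :: "(nat \<Rightarrow> real) \<Rightarrow> (real \<Rightarrow> real) \<Rightarrow> nat \<Rightarrow> real" where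
  "abar t g j = cell_mean g (t (j - 1)) (tau t j)
     - cell_moment g (t (j - 1)) (tau t j) / (1 + rho t (j + 1))"

definition dbar :: "(nat \<Rightarrow> real) \<Rightarrow> (real \<Rightarrow> real) \<Rightarrow> nat \<Rightarrow> real" where
  "dbar t g j = (if j = 0 then 0 else cbar t g (j - 1) + abar t g j)"

text \<open>Merges the moments over one cell that \<open>c_k\<close> and \<open>d_k\<close> both
  contain; the resulting \<open>1 / r\<close> is the one that appears in
  \<open>mesh_ratio\<close>.\<close>

lemma frac_split:
  fixes q r :: real
  assumes "0 < r"
  shows "q / (r * (1 + r)) + q / (1 + r) = q / r"
proof -
  have "q / (1 + r) = q * r / (r * (1 + r))" using assms by simp
  then have "q / (r * (1 + r)) + q / (1 + r) = q * (1 + r) / (r * (1 + r))"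
    by (simp add: add_divide_distrib distrib_left)
  then show ?thesis using assms by simp
qed

lemma t_mono: "mesh_ok t \<Longrightarrow> i \<le> j \<Longrightarrow> t i \<le> t j"
  unfolding mesh_ok_def by (auto simp: strict_mono_less_eq)

lemma cell_end: "t (j - Suc 0) + tau t j = t j"
  by (simp add: tau_def)

text \<open>\<open>g\<close> stays general because the results are needed both for the kernel of one
  row and for the difference of the kernels of two consecutive rows.\<close>

context
  fixes t :: "nat \<Rightarrow> real" and g g' :: "real \<Rightarrow> real" and k :: nat
  assumes mesh: "mesh_ok t" and g: "convex_incr g g' (t k)"
begin

lemma convex_incr_prev: "j \<le> k \<Longrightarrow> convex_incr g g' (t j)"
  using convex_incr_le[OF g] t_mono[OF mesh] by blast

lemma cell_moment_nonneg:
  assumes "1 \<le> j" "j \<le> k"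
  shows "0 \<le> cell_moment g (t (j - 1)) (tau t j)"
proof -
  have cv: "convex_incr g g' (t j)" using convex_incr_prev assms by blast
  have le: "t (j - 1) + tau t j \<le> t j" by (simp add: cell_end)
  have "0 \<le> g' s" if "t (j - 1) \<le> s" "s \<le> t (j - 1) + tau t j" for s
    using convex_incr_slope_nonneg[OF cv] that le by auto
  from moment_ge[OF cv le tau_pos[OF mesh assms(1)] this] show ?thesis by simp
qed

lemma cbar_nonneg: "j \<le> k \<Longrightarrow> 0 \<le> cbar t g j"
  using cell_moment_nonneg[of j] rho_pos[OF mesh, of "j + 1"] by (cases "j = 0") (simp_all add: cbar_def)

text \<open>\<open>abar\<close> is the average of \<open>g\<close> with weight
  \<open>1 - (2 * \<theta> - 1) / (1 + r)\<close>, to which the weighted bound applies because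
  \<open>1 / (1 + r)\<close> lies between 0 and 1.\<close>

lemma abar_ge: "1 \<le> j \<Longrightarrow> j \<le> k \<Longrightarrow> g (t (j - 1)) \<le> abar t g j"
  using weighted_ge[OF convex_incr_prev, of j "t (j - 1)" "tau t j" "1 / (1 + rho t (j + 1))"]
    tau_pos[OF mesh, of j] rho_pos[OF mesh, of "j + 1"]
  by (simp add: cell_end abar_def)

lemma abar_le: "1 \<le> j \<Longrightarrow> j \<le> k \<Longrightarrow> abar t g j \<le> cell_mean g (t (j - 1)) (tau t j)"
  using cell_moment_nonneg[of j] rho_pos[OF mesh, of "j + 1"] by (simp add: abar_def)

text \<open>The slope \<open>\<kappa>\<close> of \<open>g\<close> at the common end point of cells \<open>k - 1\<close> and \<open>k\<close> separates the two
  moments, and the mesh condition is exactly what makes the \<open>\<kappa>\<close>-terms nonnegative.\<close>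
lemma cbar_minus_dbar: "1 \<le> k \<Longrightarrow> - g (t k) \<le> cbar t g k - dbar t g k"
proof -
  assume k: "1 \<le> k"
  let ?m = "cell_mean g (t (k - 1)) (tau t k)" and ?q = "cell_moment g (t (k - 1)) (tau t k)"
  let ?r = "rho t (k + 1)"
  define \<kappa> where "\<kappa> = g' (t (k - 1))"
  have le_k: "t (k - 1) \<le> t k" using t_mono[OF mesh] by simp
  have end_k: "t (k - 1) + tau t k \<le> t k" by (simp add: cell_end)
  have \<kappa>0: "0 \<le> \<kappa>" unfolding \<kappa>_def by (rule convex_incr_slope_nonneg[OF g le_k])
  have tk: "0 < tau t k" and r: "0 < ?r" using tau_pos[OF mesh k] rho_pos[OF mesh] k by auto
  have ge: "\<kappa> \<le> g' s" if "t (k - 1) \<le> s" "s \<le> t (k - 1) + tau t k" for s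
    unfolding \<kappa>_def by (rule convex_incr_slope_mono[OF g that(1)]) (use that end_k in linarith)
  have m: "?m \<le> g (t k) - \<kappa> * tau t k / 2"
    using mean_le[OF g end_k tk ge] by (simp add: cell_end)
  have q: "\<kappa> * tau t k / 6 \<le> ?q"
    by (rule moment_ge[OF g end_k tk ge])
  have eq: "cbar t g k - dbar t g k = ?q / ?r - ?m - cbar t g (k - 1)"
  proof -
    have "?q / (?r * (1 + ?r)) + ?q / (1 + ?r) = ?q / ?r"
      using r by (intro frac_split)
    then show ?thesis using k by (simp add: cbar_def dbar_def abar_def)
  qed
  \<comment> \<open>The previous moment is at most \<open>\<kappa> * tau t (k - 1) / 6\<close>.
    Writing \<open>tau t (k - 1)\<close> as \<open>tau t k / s\<close> turns the factor
    \<open>1 / (s * (1 + s))\<close> of \<open>cbar\<close> into the left side of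
    \<open>mesh_ratio\<close>.\<close>
  have c: "cbar t g (k - 1) \<le> \<kappa> * tau t k / 6 * (3 + 1 / ?r)"
  proof (cases "k = 1")
    case True
    then show ?thesis using \<kappa>0 tk r by (simp add: cbar_def)
  next
    case False
    then have k2: "2 \<le> k" using k by simp
    let ?s = "rho t k"
    have s: "0 < ?s" and tk': "0 < tau t (k - 1)" using rho_pos[OF mesh k2] tau_pos[OF mesh] k2 by auto
    have le: "g' s \<le> \<kappa>" if "t (k - 1 - 1) \<le> s" "s \<le> t (k - 1 - 1) + tau t (k - 1)" for s
      unfolding \<kappa>_def by (rule convex_incr_slope_mono[OF g _ le_k]) (use that cell_end[of t "k - 1"] in simp)
    have "cell_moment g (t (k - 1 - 1)) (tau t (k - 1)) \<le> \<kappa> * tau t (k - 1) / 6"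
      by (rule moment_le[OF g _ tk' le]) (use le_k cell_end[of t "k - 1"] in simp)
    then have "cbar t g (k - 1) \<le> \<kappa> * tau t (k - 1) / 6 / (?s * (1 + ?s))"
      using divide_right_mono[of _ _ "?s * (1 + ?s)"] k2 s by (simp add: cbar_def del: divide_divide_eq_left times_divide_eq_right)
    also have "tau t (k - 1) = tau t k / ?s" using tk tk' by (simp add: rho_def)
    also have "\<kappa> * (tau t k / ?s) / 6 / (?s * (1 + ?s)) = \<kappa> * tau t k / 6 * (1 / (?s\<^sup>2 * (1 + ?s)))"
      by (simp add: power2_eq_square mult.assoc)
    also have "\<dots> \<le> \<kappa> * tau t k / 6 * (3 + 1 / ?r)"
      using mesh_ratio[OF mesh k2] \<kappa>0 tk by (intro mult_left_mono) auto
    finally show ?thesis .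
  qed
  have "\<kappa> * tau t k / 6 / ?r \<le> ?q / ?r" using q r by (intro divide_right_mono) auto
  \<comment> \<open>The part with 3 is paid for by the deficit \<open>\<kappa> * tau t k / 2\<close>
    of the mean in \<open>m\<close>, the part with \<open>1 / ?r\<close> by the moment term
    \<open>?q / ?r\<close>.\<close>
  moreover have "\<kappa> * tau t k / 6 * (3 + 1 / ?r) = \<kappa> * tau t k / 2 + \<kappa> * tau t k / 6 / ?r"
    by (simp add: distrib_left)
  ultimately show ?thesis using m c eq by linarith
qed

end

text \<open>The increment is \<open>(cbar - dbar)\<close> at \<open>j - 1\<close> plus
  \<open>abar\<close> at \<open>j\<close>; the first is at least \<open>- g (t (j - 1))\<close>, the
  second at least \<open>g (t (j - 1))\<close>. For \<open>j = 1\<close> there is no preceding cell,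
  which is where the sign of \<open>g (t 0)\<close> enters.\<close>

lemma dbar_increment_nonneg:
  assumes mesh: "mesh_ok t" and g: "convex_incr g g' (t j)" and j: "1 \<le> j"
    and nn: "0 \<le> g (t 0)"
  shows "dbar t g (j - 1) \<le> dbar t g j"
proof (cases "j = 1")
  case True
  then show ?thesis using abar_ge[OF mesh g, of 1] nn by (simp add: dbar_def cbar_def)
next
  case False
  have "convex_incr g g' (t (j - 1))"
    using convex_incr_prev[OF mesh g] by simp
  have "1 \<le> j - 1" using False j by simp
  with \<open>convex_incr g g' (t (j - 1))\<close> have "- g (t (j - 1)) \<le> cbar t g (j - 1) - dbar t g (j - 1)"
    using cbar_minus_dbar[OF mesh] by blast
  then show ?thesis using abar_ge[OF mesh g j] j by (simp add: dbar_def)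
qed

lemma dbar_diff:
  assumes mesh: "mesh_ok t" and g: "convex_incr g g' (t k)" and h: "convex_incr h h' (t k)" and j: "j \<le> k"
  shows "cbar t (\<lambda>s. g s - h s) j = cbar t g j - cbar t h j"
    and "dbar t (\<lambda>s. g s - h s) j = dbar t g j - dbar t h j"
proof -
  have *: "cell_mean (\<lambda>s. g s - h s) (t (i - 1)) (tau t i)
        = cell_mean g (t (i - 1)) (tau t i) - cell_mean h (t (i - 1)) (tau t i)"
      "cell_moment (\<lambda>s. g s - h s) (t (i - 1)) (tau t i)
        = cell_moment g (t (i - 1)) (tau t i) - cell_moment h (t (i - 1)) (tau t i)"
    if "1 \<le> i" "i \<le> k" for i
    using that tau_pos[OF mesh, of i]
    by (auto intro!: cell_mean_diff[OF convex_incr_prev[OF mesh g] convex_incr_prev[OF mesh h]]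
          cell_moment_diff[OF convex_incr_prev[OF mesh g] convex_incr_prev[OF mesh h]] simp: cell_end)
  show "cbar t (\<lambda>s. g s - h s) j = cbar t g j - cbar t h j"
    using *[of j] j by (simp add: cbar_def diff_divide_distrib)
  show "dbar t (\<lambda>s. g s - h s) j = dbar t g j - dbar t h j"
    using *[of j] *[of "j - 1"] j
    by (cases "j = 1") (simp_all add: dbar_def cbar_def abar_def diff_divide_distrib)
qed

section \<open>The scheme as a monotone triangular matrix\<close>

lemma tstar_bounds:
  assumes "mesh_ok t" "1 \<le> k" "1 / 2 < \<sigma>" "\<sigma> < 1"
  shows "t (k - 1) < tstar \<sigma> t k" "tstar \<sigma> t k \<le> t k" "tstar \<sigma> t k \<le> tstar \<sigma> t (k + 1)"
    "t k < tstar \<sigma> t (k + 1)"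
proof -
  have "0 < tau t k" "0 < tau t (k + 1)" using tau_pos assms by auto
  moreover have "\<sigma> * tau t k \<le> 1 * tau t k" "0 < \<sigma> * tau t k" "0 < \<sigma> * tau t (k + 1)"
    using calculation assms by (simp_all add: mult_right_mono)
  ultimately show "t (k - 1) < tstar \<sigma> t k" "tstar \<sigma> t k \<le> t k" "tstar \<sigma> t k \<le> tstar \<sigma> t (k + 1)"
    "t k < tstar \<sigma> t (k + 1)"
    using cell_end[of t k] by (simp_all add: tstar_def)
qed

text \<open>The position of \<open>t j\<close> before the singularity makes the kernel continuous on
  the cell, so the integral can be split into moment and mean. For \<open>k = 1\<close> the
  coefficient is zero by convention, hence \<open>k \<noteq> 1\<close>.\<close>

lemma acoef_eq_abar:
  assumes mesh: "mesh_ok t" and \<alpha>: "0 < \<alpha>" and j: "1 \<le> j" "k \<noteq> 1" and T: "t j < tstar \<sigma> t k"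
  shows "acoef \<alpha> \<sigma> t k j = - abar t (frac_kernel \<alpha> (tstar \<sigma> t k)) j"
proof -
  let ?T = "tstar \<sigma> t k" and ?r = "rho t (j + 1)"
  let ?g = "\<lambda>\<theta>. frac_kernel \<alpha> ?T (t (j - 1) + \<theta> * tau t j)"
  have tj: "0 < tau t j" "0 < tau t (j + 1)" using tau_pos[OF mesh] j by auto
  have cont: "continuous_on {0..1} ?g"
    using convex_incr_continuous[OF convex_incr_kernel[OF \<alpha> T]] tj by (simp add: cell_end)
  have r: "tau t j / (tau t j + tau t (j + 1)) = 1 / (1 + ?r)"
    using tj by (simp add: rho_def field_simps)
  have pt: "(- 2 * tau t j * (1 - \<theta>) - tau t (j + 1)) /
        ((tau t j + tau t (j + 1)) * (?T - t (j - 1) - \<theta> * tau t j) powr \<alpha>)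
      = 1 / (1 + ?r) * ((2 * \<theta> - 1) * ?g \<theta>) - ?g \<theta>" for \<theta>
  proof -
    have "(- 2 * tau t j * (1 - \<theta>) - tau t (j + 1)) / (tau t j + tau t (j + 1))
        = tau t j / (tau t j + tau t (j + 1)) * (2 * \<theta> - 1) - 1"
      using tj by (simp add: field_simps)
    then have "(- 2 * tau t j * (1 - \<theta>) - tau t (j + 1)) / (tau t j + tau t (j + 1))
        = 1 / (1 + ?r) * (2 * \<theta> - 1) - 1" unfolding r .
    moreover have "?g \<theta> = 1 / (?T - t (j - 1) - \<theta> * tau t j) powr \<alpha>"
      by (simp add: frac_kernel_def powr_minus_divide diff_diff_eq)
    ultimately have "(- 2 * tau t j * (1 - \<theta>) - tau t (j + 1)) /
        ((tau t j + tau t (j + 1)) * (?T - t (j - 1) - \<theta> * tau t j) powr \<alpha>)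
      = (1 / (1 + ?r) * (2 * \<theta> - 1) - 1) * ?g \<theta>"
      by (simp add: divide_divide_eq_left[symmetric])
    then show ?thesis by (simp add: left_diff_distrib)
  qed
  have "acoef \<alpha> \<sigma> t k j = integral {0..1} (\<lambda>\<theta>. 1 / (1 + ?r) * ((2 * \<theta> - 1) * ?g \<theta>) - ?g \<theta>)"
    using j by (simp only: acoef_def if_False pt)
  also have "\<dots> = integral {0..1} (\<lambda>\<theta>. 1 / (1 + ?r) * ((2 * \<theta> - 1) * ?g \<theta>)) - integral {0..1} ?g"
    by (intro integral_diff integrable_continuous_interval continuous_intros cont)
  also have "\<dots> = - abar t (frac_kernel \<alpha> ?T) j"
    unfolding integral_mult_right by (simp add: abar_def cell_mean_def cell_moment_def)
  finally show ?thesis .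
qed

lemma ccoef_eq_cbar:
  assumes mesh: "mesh_ok t" and j: "1 \<le> j" "k \<noteq> 1"
  shows "ccoef \<alpha> \<sigma> t k j = cbar t (frac_kernel \<alpha> (tstar \<sigma> t k)) j"
proof -
  let ?T = "tstar \<sigma> t k" and ?r = "rho t (j + 1)"
  let ?g = "\<lambda>\<theta>. frac_kernel \<alpha> ?T (t (j - 1) + \<theta> * tau t j)"
  have tj: "0 < tau t j" "0 < tau t (j + 1)" using tau_pos[OF mesh] j by auto
  have r: "(tau t j)\<^sup>2 / (tau t (j + 1) * (tau t j + tau t (j + 1))) = 1 / (?r * (1 + ?r))"
    using tj by (simp add: rho_def field_simps power2_eq_square)
  have pt: "((tau t j)\<^sup>2 * (2 * \<theta> - 1)) /
        (tau t (j + 1) * (tau t j + tau t (j + 1)) * (?T - t (j - 1) - \<theta> * tau t j) powr \<alpha>)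
      = 1 / (?r * (1 + ?r)) * ((2 * \<theta> - 1) * ?g \<theta>)" for \<theta>
    unfolding r[symmetric] by (simp add: frac_kernel_def powr_minus_divide diff_diff_eq)
  have "ccoef \<alpha> \<sigma> t k j = integral {0..1} (\<lambda>\<theta>. 1 / (?r * (1 + ?r)) * ((2 * \<theta> - 1) * ?g \<theta>))"
    using j by (simp only: ccoef_def if_False pt)
  then show ?thesis
    unfolding integral_mult_right using j by (simp add: cbar_def cell_moment_def)
qed

text \<open>The diagonal carries twice the coefficient of \<open>\<delta>\<^sub>k u\<close>, as the quadratic form above halves it.\<close>
definition scheme_matrix :: "real \<Rightarrow> (nat \<Rightarrow> real) \<Rightarrow> nat \<Rightarrow> nat \<Rightarrow> real" where
  "scheme_matrix \<alpha> t k j =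
    (if j = 0 then 0
     else if j < k then dbar t (frac_kernel \<alpha> (tstar (1 - \<alpha> / 2) t k)) j
     else 2 * (cbar t (frac_kernel \<alpha> (tstar (1 - \<alpha> / 2) t k)) (k - 1)
            + (1 - \<alpha> / 2) powr (1 - \<alpha>) / ((1 - \<alpha>) * tau t k powr \<alpha>)))"

text \<open>Row \<open>k + 1\<close> is strictly below the diagonal for all
  \<open>j \<le> k\<close>, so its increments are those of \<open>dbar\<close>. For
  \<open>j < k\<close> both rows are of this kind and linearity reduces the second claim to the
  difference of the kernels; \<open>j = k\<close> compares with the diagonal entry.\<close>

lemma scheme_matrix_monotone:
  assumes mesh: "mesh_ok t" and \<alpha>: "0 < \<alpha>" "\<alpha> < 1" and j: "1 \<le> j" "j \<le> k"
  defines "A \<equiv> scheme_matrix \<alpha> t"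
  shows "A (Suc k) (j - 1) \<le> A (Suc k) j"
    and "A (Suc k) j - A (Suc k) (j - 1) \<le> A k j - A k (j - 1)"
proof -
  let ?\<sigma> = "1 - \<alpha> / 2"
  define T where "T = tstar ?\<sigma> t k"
  define T' where "T' = tstar ?\<sigma> t (Suc k)"
  have T: "t (k - 1) < T" "T \<le> T'" "t k < T'" "T \<le> t k"
    using tstar_bounds[OF mesh, of k ?\<sigma>] \<alpha> j by (auto simp: T_def T'_def)
  have cv': "convex_incr (frac_kernel \<alpha> T') (\<lambda>s. \<alpha> * (T' - s) powr (- \<alpha> - 1)) (t k)"
    by (rule convex_incr_kernel[OF \<alpha>(1) T(3)])
  have A': "A (Suc k) i = dbar t (frac_kernel \<alpha> T') i" if "i \<le> k" for i
    using that by (auto simp: A_def scheme_matrix_def T'_def dbar_def)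
  have A0: "A k i = dbar t (frac_kernel \<alpha> T) i" if "i < k" for i
    using that by (auto simp: A_def scheme_matrix_def T_def dbar_def)
  show row: "A (Suc k) (j - 1) \<le> A (Suc k) j"
  proof -
    have "0 \<le> frac_kernel \<alpha> T' (t 0)" by (simp add: frac_kernel_def)
    from dbar_increment_nonneg[OF mesh convex_incr_prev[OF mesh cv' j(2)] j(1) this]
    show ?thesis using j by (simp add: A')
  qed
  let ?g = "\<lambda>s. frac_kernel \<alpha> T s - frac_kernel \<alpha> T' s"
  let ?g' = "\<lambda>s. \<alpha> * (T - s) powr (- \<alpha> - 1) - \<alpha> * (T' - s) powr (- \<alpha> - 1)"
  have cv: "convex_incr (frac_kernel \<alpha> T) (\<lambda>s. \<alpha> * (T - s) powr (- \<alpha> - 1)) (t (k - 1))"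
    by (rule convex_incr_kernel[OF \<alpha>(1) T(1)])
  have cvg: "convex_incr ?g ?g' (t (k - 1))"
    by (rule convex_incr_kernel_diff[OF \<alpha>(1) T(1,2)])
  have cv'': "convex_incr (frac_kernel \<alpha> T') (\<lambda>s. \<alpha> * (T' - s) powr (- \<alpha> - 1)) (t (k - 1))"
    using convex_incr_prev[OF mesh cv'] by simp
  note diff = dbar_diff[OF mesh cv cv'']
  show "A (Suc k) j - A (Suc k) (j - 1) \<le> A k j - A k (j - 1)"
  proof (cases "j < k")
    case True
    have "t 0 < T" using T t_mono[OF mesh, of 0 "k - 1"] by linarith
    then have "0 \<le> ?g (t 0)"
      using T \<alpha> by (auto simp: frac_kernel_def intro!: powr_mono2')
    moreover have "convex_incr ?g ?g' (t j)"
      using convex_incr_prev[OF mesh cvg] True by simp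
    ultimately have "dbar t ?g (j - 1) \<le> dbar t ?g j"
      using dbar_increment_nonneg[OF mesh] j by blast
    then show ?thesis using True by (simp add: A' A0 diff)
  next
    case False
    \<comment> \<open>By linearity the claim becomes
      \<open>abar' - 2 * S \<le> cbar + (cbar - dbar)\<close>, with \<open>abar'\<close> taken for
      the kernel of row \<open>k + 1\<close> at \<open>k\<close>, the first \<open>cbar\<close> for
      that of row \<open>k\<close> and the bracket for \<open>?g\<close>, all at
      \<open>k - 1\<close>. The bracket is at least minus the kernel of row \<open>k\<close> at
      \<open>t (k - 1)\<close>, and \<open>diagonal_bound\<close> covers that loss together with
      \<open>abar'\<close>.\<close>
    then have jk: "j = k" and k: "1 \<le> k" using j by auto
    let ?S = "?\<sigma> powr (1 - \<alpha>) / ((1 - \<alpha>) * tau t k powr \<alpha>)"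
    have tk: "0 < tau t k" using tau_pos[OF mesh k] .
    have "(?\<sigma> * tau t k) powr (- \<alpha>) + cell_mean (frac_kernel \<alpha> T') (t (k - 1)) (tau t k) \<le> 2 * ?S"
      using diagonal_bound[OF \<alpha> tk] T by (simp add: cell_end)
    then have S: "(?\<sigma> * tau t k) powr (- \<alpha>) + abar t (frac_kernel \<alpha> T') k \<le> 2 * ?S"
      using abar_le[OF mesh cv' k] by simp
    have Akk: "A k k = 2 * (cbar t (frac_kernel \<alpha> T) (k - 1) + ?S)"
      using k by (simp add: A_def scheme_matrix_def T_def)
    have "T - t (k - 1) = ?\<sigma> * tau t k" by (simp add: T_def tstar_def)
    then have gk: "?g (t (k - 1)) \<le> (?\<sigma> * tau t k) powr (- \<alpha>)"
      by (simp add: frac_kernel_def)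
    \<comment> \<open>For \<open>k = 1\<close> there is no cell \<open>k - 1\<close>; both
      coefficients are then zero by convention and the weaker bound below is trivial.\<close>
    have "- ?g (t (k - 1)) \<le> cbar t ?g (k - 1) - dbar t ?g (k - 1)" if "k \<noteq> 1"
      using cbar_minus_dbar[OF mesh cvg] that k by simp
    then have "- ((?\<sigma> * tau t k) powr (- \<alpha>)) \<le> cbar t ?g (k - 1) - dbar t ?g (k - 1)"
      using gk by (cases "k = 1") (auto simp: cbar_def dbar_def)
    moreover have "0 \<le> cbar t (frac_kernel \<alpha> T) (k - 1)" using cbar_nonneg[OF mesh cv] by simp
    moreover have "dbar t (frac_kernel \<alpha> T') k = cbar t (frac_kernel \<alpha> T') (k - 1) + abar t (frac_kernel \<alpha> T') k"
      using k by (simp add: dbar_def)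
    ultimately show ?thesis
      using S k unfolding jk by (simp add: A' A0 Akk diff)
  qed
qed

text \<open>\<open>Gamma (2 - \<alpha>) = (1 - \<alpha>) * Gamma (1 - \<alpha>)\<close> gives the
  history and the local term a common prefactor.\<close>

lemma Lop_eq_scheme_matrix:
  assumes mesh: "mesh_ok t" and \<alpha>: "0 < \<alpha>" "\<alpha> < 1" and k: "1 \<le> k"
  shows "Lop \<alpha> (1 - \<alpha> / 2) t k u x = 1 / Gamma (1 - \<alpha>) *
    ((\<Sum>j=1..<k. scheme_matrix \<alpha> t k j * (u j x - u (j - 1) x))
      + scheme_matrix \<alpha> t k k / 2 * (u k x - u (k - 1) x))"
proof -
  let ?\<sigma> = "1 - \<alpha> / 2" and ?h = "frac_kernel \<alpha> (tstar (1 - \<alpha> / 2) t k)"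
  let ?\<delta> = "\<lambda>j. u j x - u (j - 1) x"
  have G: "Gamma (2 - \<alpha>) = (1 - \<alpha>) * Gamma (1 - \<alpha>)"
    using Gamma_plus1[of "1 - \<alpha>"] nonpos_Ints_nonpos[of "1 - \<alpha>"] \<alpha> by auto
  have sig: "?\<sigma> powr (1 - \<alpha>) / (Gamma (2 - \<alpha>) * tau t k powr \<alpha>)
      = 1 / Gamma (1 - \<alpha>) * (?\<sigma> powr (1 - \<alpha>) / ((1 - \<alpha>) * tau t k powr \<alpha>))"
    unfolding G by simp
  have Akk: "scheme_matrix \<alpha> t k k / 2 = cbar t ?h (k - 1) + ?\<sigma> powr (1 - \<alpha>) / ((1 - \<alpha>) * tau t k powr \<alpha>)"
    using k by (simp add: scheme_matrix_def)
  have coeffs: "ccoef \<alpha> ?\<sigma> t k (k - 1) * ?\<delta> k - acoef \<alpha> ?\<sigma> t k 1 * (u 1 x - u 0 x)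
        + (\<Sum>j\<in>{2..k - 1}. dcoef \<alpha> ?\<sigma> t k j * ?\<delta> j)
      = cbar t ?h (k - 1) * ?\<delta> k + (\<Sum>j=1..<k. scheme_matrix \<alpha> t k j * ?\<delta> j)"
  proof (cases "k = 1")
    case True
    then show ?thesis by (simp add: acoef_def ccoef_def cbar_def)
  next
    case False
    then have k2: "2 \<le> k" using k by simp
    have lt: "t j < tstar ?\<sigma> t k" if "j < k" for j
    proof -
      have "t j \<le> t (k - 1)" using t_mono[OF mesh] that by simp
      also have "\<dots> < tstar ?\<sigma> t k" using tstar_bounds(1)[OF mesh k] \<alpha> by simp
      finally show ?thesis .
    qed
    have a: "acoef \<alpha> ?\<sigma> t k j = - abar t ?h j" if "1 \<le> j" "j < k" for j
      using acoef_eq_abar[OF mesh \<alpha>(1) that(1) False lt[OF that(2)]] .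
    have c: "ccoef \<alpha> ?\<sigma> t k j = cbar t ?h j" if "1 \<le> j" for j
      using ccoef_eq_cbar[OF mesh that False] .
    \<comment> \<open>The separate term \<open>- a_1\<close> becomes the entry \<open>j = 1\<close>,
      since \<open>cbar\<close> at 0 is 0 and so \<open>dbar\<close> and \<open>abar\<close> agree
      at 1.\<close>
    have set: "{1..<k} = insert 1 {2..k - 1}" using k2 by auto
    have "(\<Sum>j=1..<k. scheme_matrix \<alpha> t k j * ?\<delta> j)
        = abar t ?h 1 * (u 1 x - u 0 x) + (\<Sum>j\<in>{2..k - 1}. scheme_matrix \<alpha> t k j * ?\<delta> j)"
      unfolding set using k2 by (simp add: scheme_matrix_def dbar_def cbar_def)
    also have "(\<Sum>j\<in>{2..k - 1}. scheme_matrix \<alpha> t k j * ?\<delta> j)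
        = (\<Sum>j\<in>{2..k - 1}. dcoef \<alpha> ?\<sigma> t k j * ?\<delta> j)"
      using k2 by (intro sum.cong) (auto simp: scheme_matrix_def dbar_def dcoef_def a c)
    finally show ?thesis using k2 by (simp add: a c)
  qed
  have "a * (b * d + c) + (a * s) * d = a * (c + (b + s) * d)" for a b c d s :: real
    by (simp add: algebra_simps)
  then show ?thesis unfolding Lop_def coeffs sig Akk by blast
qed

lemma Lop_form_nonneg:
  assumes mesh: "mesh_ok t" and \<alpha>: "0 < \<alpha>" "\<alpha> < 1"
  shows "0 \<le> (\<Sum>k=1..n. Lop \<alpha> (1 - \<alpha> / 2) t k u x * (u k x - u (k - 1) x))"
proof -
  let ?A = "scheme_matrix \<alpha> t" and ?\<delta> = "\<lambda>k. u k x - u (k - 1) x"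
  note mono = scheme_matrix_monotone[OF mesh \<alpha>]
  have "0 \<le> (\<Sum>k=1..n. ?\<delta> k * ((\<Sum>j=1..<k. ?A k j * ?\<delta> j) + ?A k k / 2 * ?\<delta> k))"
  proof (rule monotone_kernel_form_nonneg)
    fix k j :: nat assume j: "1 \<le> j" "j \<le> k"
    \<comment> \<open>Both parts together: the increment of row \<open>k\<close> is at least that of
      row \<open>k + 1\<close>, which is nonnegative. This includes the diagonal increment of row
      \<open>k\<close>.\<close>
    show "?A k (j - 1) \<le> ?A k j" using mono[OF j] by linarith
    show "?A (Suc k) j - ?A (Suc k) (j - 1) \<le> ?A k j - ?A k (j - 1)" using mono(2)[OF j] .
  qed (simp add: scheme_matrix_def)
  then have "0 \<le> 1 / Gamma (1 - \<alpha>) *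
      (\<Sum>k=1..n. ?\<delta> k * ((\<Sum>j=1..<k. ?A k j * ?\<delta> j) + ?A k k / 2 * ?\<delta> k))"
    using Gamma_real_pos[of "1 - \<alpha>"] \<alpha> by simp
  also have "\<dots> = (\<Sum>k=1..n. Lop \<alpha> (1 - \<alpha> / 2) t k u x * ?\<delta> k)"
    unfolding sum_distrib_left
    by (intro sum.cong) (auto simp: Lop_eq_scheme_matrix[OF mesh \<alpha>] mult_ac)
  finally show ?thesis .
qed

subsection \<open>Square integrable functions\<close>

text \<open>One notion for scalar functions and vector fields: the inner product on the reals is
  multiplication, so each lemma below serves both \<open>L2\<close> and
  \<open>L2vec\<close>.\<close>

definition sq_integrable :: "'a measure \<Rightarrow> ('a \<Rightarrow> 'b::euclidean_space) \<Rightarrow> bool" where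
  "sq_integrable M f \<longleftrightarrow> f \<in> borel_measurable M \<and> integrable M (\<lambda>x. (norm (f x))\<^sup>2)"

definition sq_norm :: "'a measure \<Rightarrow> ('a \<Rightarrow> 'b::euclidean_space) \<Rightarrow> real" where
  "sq_norm M f = sqrt (integral\<^sup>L M (\<lambda>x. (norm (f x))\<^sup>2))"

lemma L2_iff: "L2 \<Omega> u \<longleftrightarrow> sq_integrable (lebesgue_on \<Omega>) u"
  by (simp add: L2_def sq_integrable_def)

lemma L2norm_eq: "L2norm \<Omega> u = sq_norm (lebesgue_on \<Omega>) u"
  by (simp add: L2norm_def sq_norm_def)

lemma L2vec_iff: "L2vec \<Omega> u \<longleftrightarrow> sq_integrable (lebesgue_on \<Omega>) u"
  by (simp add: L2vec_def sq_integrable_def)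

lemma L2vec_norm_eq: "L2vec_norm \<Omega> u = sq_norm (lebesgue_on \<Omega>) u"
  by (simp add: L2vec_norm_def sq_norm_def)

lemma sq_norm_nonneg: "0 \<le> sq_norm M f"
  by (simp add: sq_norm_def)

lemma sq_norm_power2: "(sq_norm M f)\<^sup>2 = integral\<^sup>L M (\<lambda>x. f x \<bullet> f x)"
  by (simp add: sq_norm_def power2_norm_eq_inner)

lemma sq_integrable_inner:
  assumes "sq_integrable M f" "sq_integrable M g"
  shows "integrable M (\<lambda>x. f x \<bullet> g x)"
proof (rule Bochner_Integration.integrable_bound)
  show "integrable M (\<lambda>x. (norm (f x))\<^sup>2 + (norm (g x))\<^sup>2)"
    using assms by (simp add: sq_integrable_def)
  show "(\<lambda>x. f x \<bullet> g x) \<in> borel_measurable M"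
    using assms by (auto simp: sq_integrable_def)
  have "\<bar>f x \<bullet> g x\<bar> \<le> (norm (f x))\<^sup>2 + (norm (g x))\<^sup>2" for x
  proof -
    have "\<bar>f x \<bullet> g x\<bar> \<le> norm (f x) * norm (g x)" by (rule Cauchy_Schwarz_ineq2)
    moreover have "0 \<le> (norm (f x) - norm (g x))\<^sup>2" "0 \<le> norm (f x) * norm (g x)" by auto
    ultimately show ?thesis by (simp add: power2_diff)
  qed
  then show "AE x in M. norm (f x \<bullet> g x) \<le> norm ((norm (f x))\<^sup>2 + (norm (g x))\<^sup>2)"
    by auto
qed

lemma sq_integrable_scaleR:
  assumes "sq_integrable M f" "c \<in> borel_measurable M" "\<And>x. x \<in> space M \<Longrightarrow> \<bar>c x\<bar> \<le> B"
  shows "sq_integrable M (\<lambda>x. c x *\<^sub>R f x)"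
    and "sq_norm M (\<lambda>x. c x *\<^sub>R f x) \<le> \<bar>B\<bar> * sq_norm M f"
proof -
  have f: "f \<in> borel_measurable M" "integrable M (\<lambda>x. (norm (f x))\<^sup>2)"
    using assms by (auto simp: sq_integrable_def)
  have le: "(norm (c x *\<^sub>R f x))\<^sup>2 \<le> B\<^sup>2 * (norm (f x))\<^sup>2" if "x \<in> space M" for x
  proof -
    have "\<bar>c x\<bar> * norm (f x) \<le> \<bar>B\<bar> * norm (f x)"
      using assms(3)[OF that] by (intro mult_right_mono) auto
    from power_mono[OF this, of 2] show ?thesis by (simp add: power_mult_distrib)
  qed
  have int: "integrable M (\<lambda>x. (norm (c x *\<^sub>R f x))\<^sup>2)"
    by (rule Bochner_Integration.integrable_bound[of M "\<lambda>x. B\<^sup>2 * (norm (f x))\<^sup>2"])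
       (use f assms(2) le in \<open>auto intro!: AE_I2\<close>)
  then show "sq_integrable M (\<lambda>x. c x *\<^sub>R f x)"
    using f assms(2) by (simp add: sq_integrable_def)
  have "integral\<^sup>L M (\<lambda>x. (norm (c x *\<^sub>R f x))\<^sup>2) \<le> integral\<^sup>L M (\<lambda>x. B\<^sup>2 * (norm (f x))\<^sup>2)"
    by (rule integral_mono[OF int]) (use f le in auto)
  then have "sq_norm M (\<lambda>x. c x *\<^sub>R f x) \<le> sqrt (B\<^sup>2 * integral\<^sup>L M (\<lambda>x. (norm (f x))\<^sup>2))"
    unfolding sq_norm_def by (intro real_sqrt_le_mono) (simp add: f(2))
  then show "sq_norm M (\<lambda>x. c x *\<^sub>R f x) \<le> \<bar>B\<bar> * sq_norm M f"
    by (simp add: sq_norm_def real_sqrt_mult)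
qed

lemma sq_integrable_add:
  assumes "sq_integrable M f" "sq_integrable M g"
  shows "sq_integrable M (\<lambda>x. f x + g x)"
proof -
  have "(norm (f x + g x))\<^sup>2 = (norm (f x))\<^sup>2 + 2 * (f x \<bullet> g x) + (norm (g x))\<^sup>2" for x
    by (simp add: power2_norm_eq_inner inner_add_left inner_add_right inner_commute)
  then show ?thesis
    using assms sq_integrable_inner[OF assms] by (simp add: sq_integrable_def borel_measurable_add)
qed

lemma sq_integrable_cmult: "sq_integrable M f \<Longrightarrow> sq_integrable M (\<lambda>x. c *\<^sub>R f x)"
  by (rule sq_integrable_scaleR(1)[where B = "\<bar>c\<bar>"]) auto

lemma sq_integrable_diff:
  assumes "sq_integrable M f" "sq_integrable M g"
  shows "sq_integrable M (\<lambda>x. f x - g x)"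
  using sq_integrable_add[OF assms(1) sq_integrable_cmult[OF assms(2), of "-1"]] by simp

lemma sq_integrable_sum:
  assumes "finite I" "\<And>i. i \<in> I \<Longrightarrow> sq_integrable M (f i)"
  shows "sq_integrable M (\<lambda>x. \<Sum>i\<in>I. f i x)"
  using assms by (induction I) (auto simp: sq_integrable_add, simp add: sq_integrable_def)

lemma sq_norm_diff_expand:
  assumes "sq_integrable M f" "sq_integrable M g"
  shows "(sq_norm M (\<lambda>x. f x - g x))\<^sup>2
    = (sq_norm M f)\<^sup>2 - 2 * integral\<^sup>L M (\<lambda>x. f x \<bullet> g x) + (sq_norm M g)\<^sup>2"
proof -
  note i = sq_integrable_inner[OF assms] sq_integrable_inner[OF assms(1,1)] sq_integrable_inner[OF assms(2,2)]
  have "(sq_norm M (\<lambda>x. f x - g x))\<^sup>2 = integral\<^sup>L M (\<lambda>x. f x \<bullet> f x - 2 * (f x \<bullet> g x) + g x \<bullet> g x)"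
    unfolding sq_norm_power2 by (simp add: inner_diff_left inner_diff_right inner_commute algebra_simps)
  also have "\<dots> = (sq_norm M f)\<^sup>2 - 2 * integral\<^sup>L M (\<lambda>x. f x \<bullet> g x) + (sq_norm M g)\<^sup>2"
    unfolding sq_norm_power2 using i by simp
  finally show ?thesis .
qed

lemma sq_norm_cmult: "sq_norm M (\<lambda>x. c *\<^sub>R f x) = \<bar>c\<bar> * sq_norm M f"
  by (simp add: sq_norm_def power_mult_distrib real_sqrt_mult)

lemma sq_norm_Cauchy_Schwarz:
  assumes f: "sq_integrable M f" and g: "sq_integrable M g"
  shows "\<bar>integral\<^sup>L M (\<lambda>x. f x \<bullet> g x)\<bar> \<le> sq_norm M f * sq_norm M g"
proof -
  define A B C where "A = sq_norm M f" and "B = sq_norm M g"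
    and "C = integral\<^sup>L M (\<lambda>x. f x \<bullet> g x)"
  have AB: "0 \<le> A" "0 \<le> B" by (auto simp: A_def B_def sq_norm_nonneg)
  have q: "0 \<le> A\<^sup>2 - 2 * l * C + l\<^sup>2 * B\<^sup>2" for l
  proof -
    have "0 \<le> (sq_norm M (\<lambda>x. f x - l *\<^sub>R g x))\<^sup>2" by simp
    also have "\<dots> = A\<^sup>2 - 2 * l * C + l\<^sup>2 * B\<^sup>2"
      unfolding sq_norm_diff_expand[OF f sq_integrable_cmult[OF g]] sq_norm_cmult
      by (simp add: A_def B_def C_def power_mult_distrib)
    finally show ?thesis .
  qed
  have "C\<^sup>2 \<le> (A * B)\<^sup>2"
  proof (cases "B = 0")
    case True
    have "C = 0"
    proof (rule ccontr)
      assume "C \<noteq> 0"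
      \<comment> \<open>This value makes the expression, linear in \<open>l\<close> when
        \<open>B = 0\<close>, equal to -1.\<close>
      then show False using q[of "(A\<^sup>2 + 1) / (2 * C)"] True by simp
    qed
    then show ?thesis by simp
  next
    case False
    \<comment> \<open>\<open>C / B\<^sup>2\<close> is the minimiser of the quadratic in
      \<open>l\<close>.\<close>
    have "0 \<le> (A\<^sup>2 - 2 * (C / B\<^sup>2) * C + (C / B\<^sup>2)\<^sup>2 * B\<^sup>2) * B\<^sup>2"
      using q[of "C / B\<^sup>2"] by (rule mult_nonneg_nonneg) simp
    also have "\<dots> = (A * B)\<^sup>2 - C\<^sup>2"
      using False by (simp add: field_simps power2_eq_square)
    finally show ?thesis by simp
  qed
  then show ?thesis
    using AB power2_le_iff_abs_le[of "A * B" C] by (simp add: A_def B_def C_def)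
qed

lemma sq_norm_diff_le:
  assumes f: "sq_integrable M f" and g: "sq_integrable M g"
  shows "sq_norm M (\<lambda>x. f x - g x) \<le> sq_norm M f + sq_norm M g"
proof (rule power2_le_imp_le)
  show "(sq_norm M (\<lambda>x. f x - g x))\<^sup>2 \<le> (sq_norm M f + sq_norm M g)\<^sup>2"
    using sq_norm_Cauchy_Schwarz[OF f g] sq_norm_diff_expand[OF f g] by (simp add: power2_sum)
qed (simp add: sq_norm_nonneg)

lemma sq_norm_tendsto_inner:
  assumes h: "sq_integrable M h" and g: "sq_integrable M g" and \<phi>: "\<And>n. sq_integrable M (\<phi> n)"
    and lim: "(\<lambda>n. sq_norm M (\<lambda>x. \<phi> n x - g x)) \<longlonglongrightarrow> 0"
  shows "(\<lambda>n. integral\<^sup>L M (\<lambda>x. h x \<bullet> \<phi> n x)) \<longlonglongrightarrow> integral\<^sup>L M (\<lambda>x. h x \<bullet> g x)"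
proof (rule LIM_zero_cancel, rule tendsto_rabs_zero_cancel, rule tendsto_sandwich[of "\<lambda>_. 0"])
  have "integral\<^sup>L M (\<lambda>x. h x \<bullet> \<phi> n x) - integral\<^sup>L M (\<lambda>x. h x \<bullet> g x)
      = integral\<^sup>L M (\<lambda>x. h x \<bullet> (\<phi> n x - g x))" for n
    using sq_integrable_inner[OF h \<phi>] sq_integrable_inner[OF h g] by (simp add: inner_diff_right)
  then show "\<forall>\<^sub>F n in sequentially. \<bar>integral\<^sup>L M (\<lambda>x. h x \<bullet> \<phi> n x) - integral\<^sup>L M (\<lambda>x. h x \<bullet> g x)\<bar>
      \<le> sq_norm M h * sq_norm M (\<lambda>x. \<phi> n x - g x)"
    using sq_norm_Cauchy_Schwarz[OF h sq_integrable_diff[OF \<phi> g]] by simp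
  show "(\<lambda>n. sq_norm M h * sq_norm M (\<lambda>x. \<phi> n x - g x)) \<longlonglongrightarrow> 0"
    using tendsto_mult_left[OF lim] by simp
qed auto

subsection \<open>Test functions and weak gradients\<close>

lemma smooth_fun_differentiable: "smooth_fun f \<Longrightarrow> f differentiable (at x)"
  unfolding smooth_fun_def by (metis empty_set empty_subsetI iter_pderiv.simps(1))

lemma smooth_fun_has_derivative: "smooth_fun f \<Longrightarrow> (f has_derivative frechet_derivative f (at x)) (at x)"
  using smooth_fun_differentiable frechet_derivative_works by blast

lemma iter_pderiv_append: "iter_pderiv (is @ js) f = iter_pderiv is (iter_pderiv js f)"
  by (induction "is") auto

lemma smooth_fun_pderiv:
  assumes "smooth_fun f" "i \<in> Basis"
  shows "smooth_fun (pderiv_dir i f)"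
proof -
  have "iter_pderiv is (pderiv_dir i f) = iter_pderiv (is @ [i]) f" for "is"
    by (simp add: iter_pderiv_append)
  then show ?thesis using assms by (simp add: smooth_fun_def)
qed

text \<open>Smoothness is a statement about all iterated derivatives, which have no convenient
  closed form for sums and products. It suffices to find a class of differentiable functions that is
  stable under partial derivatives.\<close>

lemma smooth_fun_coinduct:
  assumes "f \<in> S" and diff: "\<And>f x. f \<in> S \<Longrightarrow> f differentiable (at x)"
    and step: "\<And>f i. f \<in> S \<Longrightarrow> i \<in> Basis \<Longrightarrow> pderiv_dir i f \<in> S"
  shows "smooth_fun f"
proof -
  have "set is \<subseteq> Basis \<Longrightarrow> iter_pderiv is f \<in> S" for "is"
    using assms(1) step by (induction "is") auto
  then show ?thesis using diff by (auto simp: smooth_fun_def)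
qed

lemma pderiv_dir_eqI: "(f has_derivative D) (at x) \<Longrightarrow> pderiv_dir i f x = D i"
  unfolding pderiv_dir_def by (metis frechet_derivative_at)

lemma pderiv_dir_lincomb:
  assumes "smooth_fun f" "smooth_fun g"
  shows "pderiv_dir i (\<lambda>x. a * f x + b * g x) = (\<lambda>x. a * pderiv_dir i f x + b * pderiv_dir i g x)"
proof
  fix x
  have "((\<lambda>x. a * f x + b * g x) has_derivative
      (\<lambda>v. a * frechet_derivative f (at x) v + b * frechet_derivative g (at x) v)) (at x)"
    using assms[THEN smooth_fun_has_derivative] by (intro has_derivative_add has_derivative_mult_right)
  from pderiv_dir_eqI[OF this]
  show "pderiv_dir i (\<lambda>x. a * f x + b * g x) x = a * pderiv_dir i f x + b * pderiv_dir i g x"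
    by (simp add: pderiv_dir_def)
qed

lemma smooth_fun_lincomb:
  assumes "smooth_fun f" "smooth_fun g"
  shows "smooth_fun (\<lambda>x. a * f x + b * g x)"
proof (rule smooth_fun_coinduct[of _ "{\<lambda>x. a * f x + b * g x | f g. smooth_fun f \<and> smooth_fun g}"])
  fix h x assume "h \<in> {\<lambda>x. a * f x + b * g x | f g. smooth_fun f \<and> smooth_fun g}"
  then obtain f g where h: "h = (\<lambda>x. a * f x + b * g x)" and "smooth_fun f" "smooth_fun g" by blast
  then show "h differentiable (at x)"
    unfolding h by (intro differentiable_add differentiable_mult differentiable_const smooth_fun_differentiable)
next
  fix h :: "'a \<Rightarrow> real" and i :: 'a
  assume "h \<in> {\<lambda>x. a * f x + b * g x | f g. smooth_fun f \<and> smooth_fun g}" and i: "i \<in> Basis"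
  then obtain f g where h: "h = (\<lambda>x. a * f x + b * g x)" and fg: "smooth_fun f" "smooth_fun g" by blast
  show "pderiv_dir i h \<in> {\<lambda>x. a * f x + b * g x | f g. smooth_fun f \<and> smooth_fun g}"
    unfolding h pderiv_dir_lincomb[OF fg] using smooth_fun_pderiv[OF _ i] fg by blast
qed (use assms in blast)

lemma smooth_fun_diff: "smooth_fun f \<Longrightarrow> smooth_fun g \<Longrightarrow> smooth_fun (\<lambda>x. f x - g x)"
  using smooth_fun_lincomb[of f g 1 "-1"] by simp

lemma pderiv_dir_diff: "smooth_fun f \<Longrightarrow> smooth_fun g \<Longrightarrow>
    pderiv_dir i (\<lambda>x. f x - g x) = (\<lambda>x. pderiv_dir i f x - pderiv_dir i g x)"
  using pderiv_dir_lincomb[of f g i 1 "-1"] by simp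

text \<open>Differentiating \<open>(x \<bullet> b) * f x\<close> leaves an extra multiple of
  \<open>f\<close>; the summand \<open>g\<close> absorbs it, so the class is stable. The factor
  \<open>1 *\<close> matches the shape of \<open>smooth_fun_lincomb\<close>.\<close>

lemma pderiv_dir_coord_mult_add:
  fixes f g :: "'a::euclidean_space \<Rightarrow> real"
  assumes "smooth_fun f" "smooth_fun g"
  shows "pderiv_dir i (\<lambda>x. (x \<bullet> b) * f x + g x)
    = (\<lambda>x. (x \<bullet> b) * pderiv_dir i f x + ((i \<bullet> b) * f x + 1 * pderiv_dir i g x))"
proof
  fix x
  have "((\<lambda>x. x \<bullet> b) has_derivative (\<lambda>v. v \<bullet> b)) (at x)"
    by (intro bounded_linear_imp_has_derivative bounded_linear_inner_left)
  from pderiv_dir_eqI[OF has_derivative_add[OF has_derivative_mult[OF this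
      smooth_fun_has_derivative[OF assms(1)]] smooth_fun_has_derivative[OF assms(2)]]]
  show "pderiv_dir i (\<lambda>x. (x \<bullet> b) * f x + g x) x
    = (x \<bullet> b) * pderiv_dir i f x + ((i \<bullet> b) * f x + 1 * pderiv_dir i g x)"
    by (simp add: pderiv_dir_def)
qed

lemma smooth_fun_coord_mult_add:
  fixes f g :: "'a::euclidean_space \<Rightarrow> real"
  assumes "smooth_fun f" "smooth_fun g"
  shows "smooth_fun (\<lambda>x. (x \<bullet> b) * f x + g x)"
proof (rule smooth_fun_coinduct[of _ "{\<lambda>x. (x \<bullet> b) * f x + g x | f g. smooth_fun f \<and> smooth_fun g}"])
  fix h :: "'a \<Rightarrow> real" and x :: 'a
  assume "h \<in> {\<lambda>x. (x \<bullet> b) * f x + g x | f g. smooth_fun f \<and> smooth_fun g}"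
  then obtain f g where h: "h = (\<lambda>x. (x \<bullet> b) * f x + g x)" and fg: "smooth_fun f" "smooth_fun g" by blast
  have "(\<lambda>x. x \<bullet> b) differentiable (at x)"
    by (intro bounded_linear_imp_differentiable bounded_linear_inner_left)
  from differentiable_add[OF differentiable_mult[OF this] smooth_fun_differentiable[OF fg(2)]]
  show "h differentiable (at x)"
    unfolding h using smooth_fun_differentiable[OF fg(1)] by blast
next
  fix h :: "'a \<Rightarrow> real" and i :: 'a
  assume "h \<in> {\<lambda>x. (x \<bullet> b) * f x + g x | f g. smooth_fun f \<and> smooth_fun g}" and i: "i \<in> Basis"
  then obtain f g where h: "h = (\<lambda>x. (x \<bullet> b) * f x + g x)" and fg: "smooth_fun f" "smooth_fun g" by blast
  show "pderiv_dir i h \<in> {\<lambda>x. (x \<bullet> b) * f x + g x | f g. smooth_fun f \<and> smooth_fun g}"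
    unfolding h pderiv_dir_coord_mult_add[OF fg]
    by (intro CollectI exI[of _ "pderiv_dir i f"]
          exI[of _ "\<lambda>x. (i \<bullet> b) * f x + 1 * pderiv_dir i g x"] conjI refl
          smooth_fun_lincomb smooth_fun_pderiv fg i)
qed (use assms in blast)

lemma pderiv_dir_zero: "pderiv_dir i (\<lambda>_. 0) = (\<lambda>_. 0)"
  by (rule ext) (rule pderiv_dir_eqI[OF has_derivative_const])

lemma smooth_fun_zero: "smooth_fun (\<lambda>_. 0)"
  by (rule smooth_fun_coinduct[of _ "{\<lambda>_. 0}"])
     (auto simp: pderiv_dir_zero)

lemma smooth_fun_coord_mult: "smooth_fun f \<Longrightarrow> smooth_fun (\<lambda>x. (x \<bullet> b) * f x)"
  using smooth_fun_coord_mult_add[OF _ smooth_fun_zero, of f b] by simp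

lemma pderiv_dir_coord_mult: "smooth_fun f \<Longrightarrow>
    pderiv_dir i (\<lambda>x. (x \<bullet> b) * f x) = (\<lambda>x. (x \<bullet> b) * pderiv_dir i f x + (i \<bullet> b) * f x)"
  using pderiv_dir_coord_mult_add[OF _ smooth_fun_zero, of f i b]
  by (simp add: pderiv_dir_zero)

section \<open>Supports of test functions\<close>

lemma in_support: "f x \<noteq> 0 \<Longrightarrow> x \<in> closure {x. f x \<noteq> 0}"
  by (rule subsetD[OF closure_subset]) simp

lemma test_fun_subsupport:
  assumes "test_fun \<Omega> f" "smooth_fun g" "\<And>x. x \<notin> closure {x. f x \<noteq> 0} \<Longrightarrow> g x = 0"
  shows "test_fun \<Omega> g"
proof -
  have "{x. g x \<noteq> 0} \<subseteq> closure {x. f x \<noteq> 0}" using assms(3) by blast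
  then have "closure {x. g x \<noteq> 0} \<subseteq> closure {x. f x \<noteq> 0}" by (simp add: closure_minimal)
  moreover have "compact (closure {x. f x \<noteq> 0} \<inter> closure {x. g x \<noteq> 0})"
    using assms(1) by (intro compact_Int_closed) (auto simp: test_fun_def)
  ultimately have "compact (closure {x. g x \<noteq> 0})" "closure {x. g x \<noteq> 0} \<subseteq> \<Omega>"
    using assms(1) by (auto simp: Int_absorb1 test_fun_def)
  then show ?thesis using assms(2) by (simp add: test_fun_def)
qed

lemma test_fun_smooth: "test_fun \<Omega> f \<Longrightarrow> smooth_fun f"
  by (simp add: test_fun_def)

lemma test_fun_pderiv:
  assumes f: "test_fun \<Omega> f" and i: "i \<in> Basis"
  shows "test_fun \<Omega> (pderiv_dir i f)"
proof (rule test_fun_subsupport[OF f smooth_fun_pderiv[OF test_fun_smooth[OF f] i]])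
  fix x assume x: "x \<notin> closure {x. f x \<noteq> 0}"
  have "(f has_derivative (\<lambda>_. 0)) (at x)"
  proof (rule has_derivative_transform_within_open[of "\<lambda>_. 0" _ x UNIV "- closure {x. f x \<noteq> 0}"])
    fix y assume "y \<in> - closure {x. f x \<noteq> 0}"
    then show "0 = f y" using in_support by force
  qed (use x in auto)
  then show "pderiv_dir i f x = 0" by (rule pderiv_dir_eqI)
qed

lemma test_fun_coord_mult:
  assumes "test_fun \<Omega> f"
  shows "test_fun \<Omega> (\<lambda>x. (x \<bullet> b) * f x)"
proof (rule test_fun_subsupport[OF assms smooth_fun_coord_mult[OF test_fun_smooth[OF assms]]])
  fix x assume "x \<notin> closure {x. f x \<noteq> 0}"
  then have "f x = 0" using in_support[of f x] by blast
  then show "(x \<bullet> b) * f x = 0" by simp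
qed

lemma test_fun_diff:
  assumes f: "test_fun \<Omega> f" and g: "test_fun \<Omega> g"
  shows "test_fun \<Omega> (\<lambda>x. f x - g x)"
proof -
  let ?K = "closure {x. f x \<noteq> 0} \<union> closure {x. g x \<noteq> 0}"
  have "{x. f x - g x \<noteq> 0} \<subseteq> ?K"
  proof
    fix x assume "x \<in> {x. f x - g x \<noteq> 0}"
    then have "f x \<noteq> 0 \<or> g x \<noteq> 0" by auto
    then show "x \<in> ?K" using in_support[of f x] in_support[of g x] by blast
  qed
  moreover have K: "compact ?K" "?K \<subseteq> \<Omega>" using f g by (auto simp: test_fun_def)
  ultimately have sub: "closure {x. f x - g x \<noteq> 0} \<subseteq> ?K"
    by (intro closure_minimal) (auto intro: compact_imp_closed)
  have "compact (?K \<inter> closure {x. f x - g x \<noteq> 0})"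
    using K by (intro compact_Int_closed) auto
  then have "compact (closure {x. f x - g x \<noteq> 0})" using sub by (simp only: Int_absorb1)
  moreover have "closure {x. f x - g x \<noteq> 0} \<subseteq> \<Omega>" using sub K(2) by (rule order_trans)
  ultimately show ?thesis
    using smooth_fun_diff[OF test_fun_smooth[OF f] test_fun_smooth[OF g]] by (simp add: test_fun_def)
qed

lemma sq_integrable_smooth:
  assumes \<Omega>: "open \<Omega>" "bounded \<Omega>" and f: "smooth_fun f"
  shows "sq_integrable (lebesgue_on \<Omega>) f"
proof -
  have meas: "\<Omega> \<in> lmeasurable" using \<Omega> by (simp add: lmeasurable_open)
  interpret finite_measure "lebesgue_on \<Omega>" by (rule finite_measure_lebesgue_on[OF meas])
  have cont: "continuous_on S f" for S
    using smooth_fun_differentiable[OF f]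
    by (intro continuous_at_imp_continuous_on) (auto intro: differentiable_imp_continuous_within)
  have "compact (f ` closure \<Omega>)" using \<Omega> cont by (intro compact_continuous_image) auto
  then obtain B where B: "\<And>x. x \<in> closure \<Omega> \<Longrightarrow> \<bar>f x\<bar> \<le> B"
    by (metis bounded_iff compact_imp_bounded image_eqI real_norm_def)
  have m: "f \<in> borel_measurable (lebesgue_on \<Omega>)"
    using cont meas by (intro continuous_imp_measurable_on_sets_lebesgue) (auto simp: fmeasurableD)
  moreover have "integrable (lebesgue_on \<Omega>) (\<lambda>x. (norm (f x))\<^sup>2)"
  proof (rule integrable_const_bound[of _ "B\<^sup>2"])
    have "\<bar>f x\<bar>\<^sup>2 \<le> B\<^sup>2" if "x \<in> \<Omega>" for x
      using B[of x] that closure_subset by (intro power_mono) auto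
    then show "AE x in lebesgue_on \<Omega>. norm ((norm (f x))\<^sup>2) \<le> B\<^sup>2"
      by (intro AE_I2) auto
  qed (use m in measurable)
  ultimately show ?thesis by (simp add: sq_integrable_def)
qed

lemma cgrad_inner: "h \<bullet> cgrad f x = (\<Sum>i\<in>Basis. (h \<bullet> i) * pderiv_dir i f x)"
  by (simp add: cgrad_def inner_sum_right mult.commute)

lemma sq_integrable_cgrad:
  assumes "open \<Omega>" "bounded \<Omega>" "smooth_fun f"
  shows "sq_integrable (lebesgue_on \<Omega>) (cgrad f)"
proof -
  have "sq_integrable (lebesgue_on \<Omega>) (\<lambda>x. pderiv_dir i f x *\<^sub>R i)" if "i \<in> Basis" for i
  proof -
    have "sq_integrable (lebesgue_on \<Omega>) (pderiv_dir i f)"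
      using sq_integrable_smooth assms smooth_fun_pderiv that by blast
    then show ?thesis using that by (auto simp: sq_integrable_def)
  qed
  then show ?thesis unfolding cgrad_def[abs_def] by (intro sq_integrable_sum) auto
qed

lemma weak_grad_diff:
  assumes "weak_grad \<Omega> u g" "weak_grad \<Omega> v h"
  shows "weak_grad \<Omega> (\<lambda>x. u x - v x) (\<lambda>x. g x - h x)"
  using assms unfolding weak_grad_def
  by (auto simp: left_diff_distrib inner_diff_left)

text \<open>Makes the increment \<open>u k - u (k - 1)\<close> admissible in the weak formulation.
  Boundedness of \<open>\<Omega>\<close> makes the approximating test functions and their gradients
  square integrable, as the triangle inequality requires.\<close>

lemma H01_diff:
  assumes \<Omega>: "open \<Omega>" "bounded \<Omega>" and u: "H01 \<Omega> u" and v: "H01 \<Omega> v"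
  shows "H01 \<Omega> (\<lambda>x. u x - v x)"
proof -
  let ?M = "lebesgue_on \<Omega>"
  obtain g \<phi> where g: "sq_integrable ?M u" "weak_grad \<Omega> u g" "sq_integrable ?M g"
      "\<And>n. test_fun \<Omega> (\<phi> n)" "(\<lambda>n. sq_norm ?M (\<lambda>x. \<phi> n x - u x)) \<longlonglongrightarrow> 0"
      "(\<lambda>n. sq_norm ?M (\<lambda>x. cgrad (\<phi> n) x - g x)) \<longlonglongrightarrow> 0"
    using u unfolding H01_def L2_iff L2vec_iff L2norm_eq L2vec_norm_eq by blast
  obtain h \<psi> where h: "sq_integrable ?M v" "weak_grad \<Omega> v h" "sq_integrable ?M h"
      "\<And>n. test_fun \<Omega> (\<psi> n)" "(\<lambda>n. sq_norm ?M (\<lambda>x. \<psi> n x - v x)) \<longlonglongrightarrow> 0"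
      "(\<lambda>n. sq_norm ?M (\<lambda>x. cgrad (\<psi> n) x - h x)) \<longlonglongrightarrow> 0"
    using v unfolding H01_def L2_iff L2vec_iff L2norm_eq L2vec_norm_eq by blast
  have lim0: "(\<lambda>n. sq_norm ?M (\<lambda>x. (a n x - b n x) - (p x - q x))) \<longlonglongrightarrow> 0"
    if "(\<lambda>n. sq_norm ?M (\<lambda>x. a n x - p x)) \<longlonglongrightarrow> 0" "(\<lambda>n. sq_norm ?M (\<lambda>x. b n x - q x)) \<longlonglongrightarrow> 0"
      "\<And>n. sq_integrable ?M (a n)" "\<And>n. sq_integrable ?M (b n)" "sq_integrable ?M p" "sq_integrable ?M q"
    for a b :: "nat \<Rightarrow> 'a \<Rightarrow> 'c::euclidean_space" and p q
  proof (rule tendsto_sandwich[of "\<lambda>_. 0"])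
    have "sq_norm ?M (\<lambda>x. (a n x - p x) - (b n x - q x))
        \<le> sq_norm ?M (\<lambda>x. a n x - p x) + sq_norm ?M (\<lambda>x. b n x - q x)" for n
      using that by (intro sq_norm_diff_le sq_integrable_diff)
    then show "\<forall>\<^sub>F n in sequentially. sq_norm ?M (\<lambda>x. (a n x - b n x) - (p x - q x))
        \<le> sq_norm ?M (\<lambda>x. a n x - p x) + sq_norm ?M (\<lambda>x. b n x - q x)"
      by (simp add: algebra_simps)
    show "(\<lambda>n. sq_norm ?M (\<lambda>x. a n x - p x) + sq_norm ?M (\<lambda>x. b n x - q x)) \<longlonglongrightarrow> 0"
      using tendsto_add[OF that(1,2)] by simp
  qed (auto simp: sq_norm_nonneg)
  have sm: "smooth_fun (\<phi> n)" "smooth_fun (\<psi> n)" for n using g h test_fun_smooth by auto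
  have cg: "cgrad (\<lambda>x. \<phi> n x - \<psi> n x) = (\<lambda>x. cgrad (\<phi> n) x - cgrad (\<psi> n) x)" for n
    by (simp add: fun_eq_iff cgrad_def pderiv_dir_diff[OF sm] scaleR_left_diff_distrib sum_subtractf)
  have "(\<lambda>n. sq_norm ?M (\<lambda>x. (\<phi> n x - \<psi> n x) - (u x - v x))) \<longlonglongrightarrow> 0"
    by (rule lim0) (use g h sq_integrable_smooth[OF \<Omega>] sm in auto)
  moreover have "(\<lambda>n. sq_norm ?M (\<lambda>x. cgrad (\<lambda>x. \<phi> n x - \<psi> n x) x - (g x - h x))) \<longlonglongrightarrow> 0"
    unfolding cg by (rule lim0) (use g h sq_integrable_cgrad[OF \<Omega>] sm in auto)
  ultimately show ?thesis
    unfolding H01_def L2_iff L2vec_iff L2norm_eq L2vec_norm_eq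
    using sq_integrable_diff[OF g(1) h(1)] sq_integrable_diff[OF g(3) h(3)]
      weak_grad_diff[OF g(2) h(2)] test_fun_diff[OF g(4) h(4)]
    by (intro exI[of _ "\<lambda>x. g x - h x"] conjI exI[of _ "\<lambda>n x. \<phi> n x - \<psi> n x"]) auto
qed

text \<open>Testing the weak gradient with \<open>\<phi>\<^sub>n\<close> multiplied by a coordinate replaces the divergence theorem.
  The partial derivatives of \<open>\<phi>\<^sub>n\<close> are themselves test functions, which compares the approximating
  gradient \<open>g\<close> with \<open>G\<close> without proving that weak gradients are unique.\<close>
lemma Poincare:
  fixes \<Omega> :: "'a::euclidean_space set"
  assumes \<Omega>: "open \<Omega>" "\<Omega> \<subseteq> cball 0 R" and R: "0 \<le> R"
    and u: "H01 \<Omega> u" and G: "weak_grad \<Omega> u G" "L2vec \<Omega> G"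
  shows "L2norm \<Omega> u \<le> 2 * R * L2vec_norm \<Omega> G"
proof -
  let ?M = "lebesgue_on \<Omega>"
  have bd: "bounded \<Omega>" by (rule bounded_subset[OF bounded_cball \<Omega>(2)])
  have M: "\<Omega> \<in> sets lebesgue" using \<Omega>(1) by (simp add: borel_open)
  obtain g \<phi> where g: "sq_integrable ?M u" "weak_grad \<Omega> u g" "sq_integrable ?M g"
      "\<And>n. test_fun \<Omega> (\<phi> n)" "(\<lambda>n. sq_norm ?M (\<lambda>x. \<phi> n x - u x)) \<longlonglongrightarrow> 0"
      "(\<lambda>n. sq_norm ?M (\<lambda>x. cgrad (\<phi> n) x - g x)) \<longlonglongrightarrow> 0"
    using u unfolding H01_def L2_iff L2vec_iff L2norm_eq L2vec_norm_eq by blast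
  have G2: "sq_integrable ?M G" using G by (simp add: L2vec_iff)
  have sm: "smooth_fun (\<phi> n)" for n using g test_fun_smooth by auto
  have \<phi>2: "sq_integrable ?M (\<phi> n)" and c\<phi>2: "sq_integrable ?M (cgrad (\<phi> n))" for n
    using sq_integrable_smooth[OF \<Omega>(1) bd sm] sq_integrable_cgrad[OF \<Omega>(1) bd sm] by auto
  note lim\<phi> = sq_norm_tendsto_inner[OF _ g(1) \<phi>2 g(5)]
  note limc = sq_norm_tendsto_inner[OF _ g(3) c\<phi>2 g(6)]
  have same: "integral\<^sup>L ?M (\<lambda>x. g x \<bullet> cgrad (\<phi> n) x) = integral\<^sup>L ?M (\<lambda>x. G x \<bullet> cgrad (\<phi> n) x)" for n
  proof -
    have t: "test_fun \<Omega> (pderiv_dir i (\<phi> n))" if "i \<in> Basis" for i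
      using test_fun_pderiv[OF g(4) that] .
    have key: "integral\<^sup>L ?M (\<lambda>x. h x \<bullet> cgrad (\<phi> n) x)
        = (\<Sum>i\<in>Basis. - integral\<^sup>L ?M (\<lambda>x. u x * pderiv_dir i (pderiv_dir i (\<phi> n)) x))"
      if "weak_grad \<Omega> u h" for h
    proof -
      have *: "integrable ?M (\<lambda>x. (h x \<bullet> i) * pderiv_dir i (\<phi> n) x)"
        "integral\<^sup>L ?M (\<lambda>x. (h x \<bullet> i) * pderiv_dir i (\<phi> n) x)
          = - integral\<^sup>L ?M (\<lambda>x. u x * pderiv_dir i (pderiv_dir i (\<phi> n)) x)" if "i \<in> Basis" for i
        using \<open>weak_grad \<Omega> u h\<close> t[OF that] that by (auto simp: weak_grad_def)
      show ?thesis unfolding cgrad_inner by (simp add: * Bochner_Integration.integral_sum)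
    qed
    show ?thesis using key[OF g(2)] key[OF G(1)] by simp
  qed
  \<comment> \<open>Since \<open>g\<close> is the limit of the \<open>cgrad (\<phi> n)\<close>, both
    sides of \<open>same\<close> converge; Cauchy-Schwarz then bounds the norm of \<open>g\<close>
    by that of \<open>G\<close>.\<close>
  have "integral\<^sup>L ?M (\<lambda>x. g x \<bullet> g x) = integral\<^sup>L ?M (\<lambda>x. G x \<bullet> g x)"
    using LIMSEQ_unique[OF limc[OF g(3)]] limc[OF G2] by (simp add: same)
  then have "(sq_norm ?M g)\<^sup>2 \<le> sq_norm ?M G * sq_norm ?M g"
    using sq_norm_Cauchy_Schwarz[OF G2 g(3)] by (simp add: sq_norm_power2)
  then have gG: "sq_norm ?M g \<le> sq_norm ?M G"
    using sq_norm_nonneg[of ?M g] sq_norm_nonneg[of ?M G]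
    by (cases "sq_norm ?M g = 0") (auto simp: power2_eq_square)
  obtain i :: 'a where i: "i \<in> Basis" using nonempty_Basis by blast
  have coord: "\<bar>x \<bullet> i\<bar> \<le> R" if "x \<in> space ?M" for x
    using that \<Omega>(2) Basis_le_norm[OF i, of x] by (auto simp: subset_iff)
  have xm: "(\<lambda>x. x \<bullet> i) \<in> borel_measurable ?M"
    using M by (intro continuous_imp_measurable_on_sets_lebesgue continuous_intros)
  define w where "w x = (x \<bullet> i) * u x" for x
  define h where "h x = w x *\<^sub>R i" for x
  define k where "k x = (x \<bullet> i) * (g x \<bullet> i)" for x
  have w: "sq_integrable ?M w" "sq_norm ?M w \<le> R * sq_norm ?M u"
    using sq_integrable_scaleR[OF g(1) xm coord] R by (simp_all add: w_def[abs_def])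
  have h: "sq_integrable ?M h" "sq_norm ?M h = sq_norm ?M w"
    using w(1) i by (auto simp: h_def[abs_def] sq_integrable_def sq_norm_def)
  have "sq_integrable ?M (\<lambda>x. g x \<bullet> i)"
    unfolding sq_integrable_def
  proof
    show m: "(\<lambda>x. g x \<bullet> i) \<in> borel_measurable ?M" using g(3) by (auto simp: sq_integrable_def)
    show "integrable ?M (\<lambda>x. (norm (g x \<bullet> i))\<^sup>2)"
    proof (rule Bochner_Integration.integrable_bound)
      show "integrable ?M (\<lambda>x. (norm (g x))\<^sup>2)" using g(3) by (simp add: sq_integrable_def)
      show "AE x in ?M. norm ((norm (g x \<bullet> i))\<^sup>2) \<le> norm ((norm (g x))\<^sup>2)"
      proof (rule AE_I2)
        fix x
        show "norm ((norm (g x \<bullet> i))\<^sup>2) \<le> norm ((norm (g x))\<^sup>2)"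
          using power_mono[OF Basis_le_norm[OF i, of "g x"], of 2] by simp
      qed
    qed (use m in measurable)
  qed
  from sq_integrable_scaleR(1)[OF this xm coord] have k: "sq_integrable ?M k"
    by (simp add: k_def[abs_def])
  \<comment> \<open>The defining identity of \<open>g\<close> for the test function
    \<open>(x \<bullet> i) * \<phi> n x\<close>, with the product rule expanded. It involves
    \<open>\<phi> n\<close> and its gradient only through inner products with fixed functions, so it
    passes to the limit.\<close>
  have eq: "integral\<^sup>L ?M (\<lambda>x. u x \<bullet> \<phi> n x) + integral\<^sup>L ?M (\<lambda>x. h x \<bullet> cgrad (\<phi> n) x)
      = - integral\<^sup>L ?M (\<lambda>x. k x \<bullet> \<phi> n x)" for n
  proof -
    have hc: "h x \<bullet> cgrad (\<phi> n) x = w x * pderiv_dir i (\<phi> n) x" for x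
    proof -
      have "h x \<bullet> cgrad (\<phi> n) x = w x * (i \<bullet> cgrad (\<phi> n) x)" by (simp add: h_def)
      also have "i \<bullet> cgrad (\<phi> n) x = pderiv_dir i (\<phi> n) x"
        using i by (simp add: cgrad_inner inner_Basis if_distrib[of "\<lambda>z. z * _"] sum.delta cong: if_cong)
      finally show ?thesis .
    qed
    have "integral\<^sup>L ?M (\<lambda>x. u x * pderiv_dir i (\<lambda>x. (x \<bullet> i) * \<phi> n x) x)
        = - integral\<^sup>L ?M (\<lambda>x. (g x \<bullet> i) * ((x \<bullet> i) * \<phi> n x))"
      using g(2) test_fun_coord_mult[OF g(4)] i by (auto simp: weak_grad_def)
    moreover have "u x * pderiv_dir i (\<lambda>x. (x \<bullet> i) * \<phi> n x) x = u x \<bullet> \<phi> n x + h x \<bullet> cgrad (\<phi> n) x" for x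
      unfolding pderiv_dir_coord_mult[OF sm] hc using i by (simp add: w_def algebra_simps)
    ultimately show ?thesis
      using sq_integrable_inner[OF g(1) \<phi>2, of n] sq_integrable_inner[OF h(1) c\<phi>2, of n]
      by (simp add: k_def mult_ac)
  qed
  have "(\<lambda>n. - integral\<^sup>L ?M (\<lambda>x. k x \<bullet> \<phi> n x)) \<longlonglongrightarrow>
      integral\<^sup>L ?M (\<lambda>x. u x \<bullet> u x) + integral\<^sup>L ?M (\<lambda>x. h x \<bullet> g x)"
    using tendsto_add[OF lim\<phi>[OF g(1)] limc[OF h(1)]] by (simp only: eq)
  from LIMSEQ_unique[OF this tendsto_minus[OF lim\<phi>[OF k]]]
  have "integral\<^sup>L ?M (\<lambda>x. u x \<bullet> u x) + integral\<^sup>L ?M (\<lambda>x. h x \<bullet> g x) = - integral\<^sup>L ?M (\<lambda>x. k x \<bullet> u x)" .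
  \<comment> \<open>The two remaining terms coincide in the limit, which gives the factor 2; the
    bound of the coordinate by \<open>R\<close> gives the rest of the constant.\<close>
  moreover have "k x \<bullet> u x = h x \<bullet> g x" for x
    by (simp add: k_def h_def w_def inner_commute mult_ac)
  ultimately have "(sq_norm ?M u)\<^sup>2 = - 2 * integral\<^sup>L ?M (\<lambda>x. h x \<bullet> g x)"
    by (simp add: sq_norm_power2)
  also have "\<dots> \<le> 2 * (sq_norm ?M h * sq_norm ?M g)"
    using sq_norm_Cauchy_Schwarz[OF h(1) g(3)] by linarith
  also have "\<dots> \<le> 2 * ((R * sq_norm ?M u) * sq_norm ?M G)"
    using w(2) h(2) gG sq_norm_nonneg R by (intro mult_left_mono mult_mono) (auto simp: sq_norm_nonneg)
  finally have "sq_norm ?M u * sq_norm ?M u \<le> sq_norm ?M u * (2 * R * sq_norm ?M G)"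
    by (simp add: power2_eq_square mult_ac)
  then have "sq_norm ?M u \<le> 2 * R * sq_norm ?M G"
    using sq_norm_nonneg[of ?M u] sq_norm_nonneg[of ?M G] R
    by (cases "sq_norm ?M u = 0") auto
  then show ?thesis by (simp add: L2norm_eq L2vec_norm_eq)
qed

subsection \<open>Energy estimate\<close>

lemma Lop_sq_integrable:
  fixes u :: "nat \<Rightarrow> 'a::euclidean_space \<Rightarrow> real"
  assumes "\<And>k. sq_integrable M (u k)"
  shows "sq_integrable M (Lop \<alpha> \<sigma> t k u)"
proof -
  have cm: "sq_integrable M (\<lambda>x. c * f x)" if "sq_integrable M f" for c and f :: "'a \<Rightarrow> real"
    using sq_integrable_cmult[OF that, of c] by simp
  have "sq_integrable M (\<lambda>x. Lop \<alpha> \<sigma> t k u x)"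
    unfolding Lop_def
    by (intro sq_integrable_add sq_integrable_diff sq_integrable_sum cm assms finite_atLeastAtMost)
  then show ?thesis by simp
qed

text \<open>Used with \<open>a k j\<close> the integral of \<open>f\<^sub>k * u\<^sub>j\<close>: the
  time difference moves from \<open>u\<close> to \<open>f\<close>, where bounded variation controls
  it.\<close>

lemma sum_diagonal_by_parts:
  fixes a :: "nat \<Rightarrow> nat \<Rightarrow> real"
  shows "(\<Sum>k=1..Suc m. a k k - a k (k - 1))
    = a (Suc m) (Suc m) - a 1 0 - (\<Sum>k=1..m. a (Suc k) k - a k k)"
  by (induction m) auto

text \<open>With the test function \<open>u k - u (k - 1)\<close>, the diffusion terms equal half
  the increment of the squared gradient norm plus \<open>(1 - \<alpha>) / 2\<close> times the
  squared norm of the gradient increment. The latter is nonnegative, and so is the summed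
  contribution of the discrete derivative.\<close>

lemma L21sigma_energy_bound:
  assumes \<Omega>: "open \<Omega>" "bounded \<Omega>" and \<alpha>: "0 < \<alpha>" "\<alpha> < 1" and mesh: "mesh_ok t"
    and f: "\<And>s. 0 \<le> s \<Longrightarrow> L2 \<Omega> (f s)" and sol: "L21sigma_solution \<Omega> \<alpha> f t u G"
  shows "(L2vec_norm \<Omega> (G m))\<^sup>2 \<le> (L2vec_norm \<Omega> (G 0))\<^sup>2 +
    2 * (\<Sum>k=1..m. integral\<^sup>L (lebesgue_on \<Omega>)
        (\<lambda>x. f (tstar (1 - \<alpha> / 2) t k) x * (u k x - u (k - 1) x)))"
proof -
  let ?M = "lebesgue_on \<Omega>" and ?\<sigma> = "1 - \<alpha> / 2"
  define F where "F k = integral\<^sup>L ?M (\<lambda>x. f (tstar ?\<sigma> t k) x * (u k x - u (k - 1) x))" for k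
  define P where "P k = integral\<^sup>L ?M (\<lambda>x. Lop \<alpha> ?\<sigma> t k u x * (u k x - u (k - 1) x))" for k
  define E where "E k = (sq_norm ?M (G k))\<^sup>2" for k
  have H: "H01 \<Omega> (u k)" "weak_grad \<Omega> (u k) (G k)" "sq_integrable ?M (G k)" for k
    using sol by (auto simp: L21sigma_solution_def L2vec_iff)
  have u2: "sq_integrable ?M (u k)" for k using H(1)[of k] by (auto simp: H01_def L2_iff)
  have Pint: "integrable ?M (\<lambda>x. Lop \<alpha> ?\<sigma> t k u x * (u k x - u (k - 1) x))" for k
    using sq_integrable_inner[OF Lop_sq_integrable[OF u2] sq_integrable_diff[OF u2 u2]] by simp
  have step: "P k + (E k - E (k - 1)) / 2 \<le> F k" if "1 \<le> k" for k
  proof -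
    let ?D = "\<lambda>x. G k x - G (k - 1) x"
    define c where "c = integral\<^sup>L ?M (\<lambda>x. G k x \<bullet> G (k - 1) x)"
    have eq: "P k + ?\<sigma> * integral\<^sup>L ?M (\<lambda>x. G k x \<bullet> ?D x)
        + \<alpha> / 2 * integral\<^sup>L ?M (\<lambda>x. G (k - 1) x \<bullet> ?D x) = F k"
      using sol that H01_diff[OF \<Omega> H(1) H(1)] weak_grad_diff[OF H(2) H(2)]
        sq_integrable_diff[OF H(3) H(3)]
      unfolding L21sigma_solution_def P_def F_def L2vec_iff by blast
    have I1: "integral\<^sup>L ?M (\<lambda>x. G k x \<bullet> ?D x) = E k - c"
      using sq_integrable_inner[OF H(3) H(3)] by (simp add: inner_diff_right E_def c_def sq_norm_power2)
    have I2: "integral\<^sup>L ?M (\<lambda>x. G (k - 1) x \<bullet> ?D x) = c - E (k - 1)"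
      using sq_integrable_inner[OF H(3) H(3)]
      by (simp add: inner_diff_right E_def c_def sq_norm_power2 inner_commute)
    have "0 \<le> E k - 2 * c + E (k - 1)"
      using sq_norm_diff_expand[OF H(3) H(3), of k "k - 1"] unfolding E_def c_def
      by (metis zero_le_power2)
    then have "0 \<le> (1 - \<alpha>) / 2 * (E k - 2 * c + E (k - 1))" using \<alpha> by simp
    then show ?thesis using eq[unfolded I1 I2] by (simp add: field_simps)
  qed
  have "0 \<le> (\<Sum>k=1..m. P k)"
  proof -
    have "(\<Sum>k=1..m. P k) = integral\<^sup>L ?M (\<lambda>x. \<Sum>k=1..m. Lop \<alpha> ?\<sigma> t k u x * (u k x - u (k - 1) x))"
      unfolding P_def by (rule Bochner_Integration.integral_sum[symmetric]) (rule Pint)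
    also have "0 \<le> \<dots>"
      by (rule Bochner_Integration.integral_nonneg) (rule Lop_form_nonneg[OF mesh \<alpha>])
    finally show ?thesis .
  qed
  moreover have "(\<Sum>k=1..m. P k + (E k - E (k - 1)) / 2) \<le> (\<Sum>k=1..m. F k)"
    by (rule sum_mono) (use step in auto)
  moreover have "(\<Sum>k=1..m. (E k - E (k - 1)) / 2) = (E m - E 0) / 2"
    by (induction m) (auto simp: field_simps)
  ultimately have "E m \<le> E 0 + 2 * (\<Sum>k=1..m. F k)" by (simp add: sum.distrib)
  then show ?thesis by (simp add: E_def F_def L2vec_norm_eq)
qed

text \<open>After summation by parts the two boundary terms cost \<open>B * U\<close> each and the
  differences of \<open>f\<close> cost \<open>V * U\<close>.\<close>

lemma source_sum_bound:
  fixes u :: "nat \<Rightarrow> 'a::euclidean_space \<Rightarrow> real"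
  assumes f: "\<And>k. sq_integrable M (f k)" and u: "\<And>k. sq_integrable M (u k)"
    and B: "\<And>k. sq_norm M (f k) \<le> B" and U: "\<And>k. k \<le> m \<Longrightarrow> sq_norm M (u k) \<le> U"
    and V: "(\<Sum>k=1..<m. sq_norm M (\<lambda>x. f (Suc k) x - f k x)) \<le> V" and m: "1 \<le> m"
  shows "(\<Sum>k=1..m. integral\<^sup>L M (\<lambda>x. f k x * (u k x - u (k - 1) x))) \<le> (2 * B + V) * U"
proof -
  define a where "a k j = integral\<^sup>L M (\<lambda>x. f k x * u j x)" for k j
  obtain p where p: "m = Suc p" using m by (cases m) auto
  have int: "integrable M (\<lambda>x. f k x * u j x)" for k j
    using sq_integrable_inner[OF f u] by simp
  have U0: "0 \<le> U" using U[of 0] sq_norm_nonneg[of M "u 0"] by simp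
  have CS: "\<bar>a k j\<bar> \<le> B * U" if "j \<le> m" for k j
  proof -
    have "\<bar>a k j\<bar> \<le> sq_norm M (f k) * sq_norm M (u j)"
      using sq_norm_Cauchy_Schwarz[OF f u] by (simp add: a_def)
    also have "\<dots> \<le> B * U"
      using B U[OF that] sq_norm_nonneg[of M "u j"] order_trans[OF sq_norm_nonneg B]
      by (intro mult_mono) auto
    finally show ?thesis .
  qed
  have "\<bar>a (Suc k) k - a k k\<bar> \<le> sq_norm M (\<lambda>x. f (Suc k) x - f k x) * U" if "k \<le> m" for k
  proof -
    have "a (Suc k) k - a k k = integral\<^sup>L M (\<lambda>x. (f (Suc k) x - f k x) * u k x)"
      using int by (simp add: a_def left_diff_distrib)
    also have "\<bar>\<dots>\<bar> \<le> sq_norm M (\<lambda>x. f (Suc k) x - f k x) * sq_norm M (u k)"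
      using sq_norm_Cauchy_Schwarz[OF sq_integrable_diff[OF f f] u] by simp
    also have "\<dots> \<le> sq_norm M (\<lambda>x. f (Suc k) x - f k x) * U"
      using U[OF that] sq_norm_nonneg by (intro mult_left_mono)
    finally show ?thesis .
  qed
  then have "(\<Sum>k=1..p. - (a (Suc k) k - a k k)) \<le> (\<Sum>k=1..p. sq_norm M (\<lambda>x. f (Suc k) x - f k x) * U)"
    by (intro sum_mono) (fastforce simp: p abs_le_iff)
  also have "\<dots> \<le> V * U"
    using V U0 p unfolding sum_distrib_right[symmetric]
    by (intro mult_right_mono) (auto simp: atLeastLessThanSuc_atLeastAtMost)
  finally have tail: "- (\<Sum>k=1..p. a (Suc k) k - a k k) \<le> V * U" by (simp only: sum_negf)
  have "(\<Sum>k=1..m. integral\<^sup>L M (\<lambda>x. f k x * (u k x - u (k - 1) x))) = (\<Sum>k=1..m. a k k - a k (k - 1))"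
    using int by (simp add: a_def right_diff_distrib)
  also have "\<dots> = a m m - a 1 0 - (\<Sum>k=1..p. a (Suc k) k - a k k)"
    unfolding p by (rule sum_diagonal_by_parts)
  also have "\<dots> \<le> B * U + B * U + V * U"
    using CS[of m m] CS[of 0 1] tail by (simp add: abs_le_iff)
  finally show ?thesis by (simp add: algebra_simps)
qed

theorem theorem2:
  fixes \<Omega> :: "'a::euclidean_space set"
  assumes "bounded_lipschitz_domain \<Omega>"
  shows "\<exists>C\<^sub>\<Omega>\<ge>0. \<forall>f. source_ok \<Omega> f \<longrightarrow>
     (\<exists>C\<^sub>f\<ge>0. \<forall>\<alpha> t u G. 0 < \<alpha> \<and> \<alpha> < 1 \<and> mesh_ok t \<and> L21sigma_solution \<Omega> \<alpha> f t u G \<longrightarrow>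
        (\<forall>n\<ge>1. L2vec_norm \<Omega> (G n) \<le> L2vec_norm \<Omega> (G 0) + 2 * C\<^sub>f * C\<^sub>\<Omega>))"
proof -
  have \<Omega>: "open \<Omega>" "bounded \<Omega>"
    using assms by (auto simp: bounded_lipschitz_domain_def lipschitz_domain_def)
  obtain R where R: "0 \<le> R" "\<Omega> \<subseteq> cball 0 R"
  proof -
    obtain r where "\<And>x. x \<in> \<Omega> \<Longrightarrow> norm x \<le> r" using \<Omega>(2) by (meson bounded_iff)
    then have "\<Omega> \<subseteq> cball 0 \<bar>r\<bar>" by (fastforce intro: order_trans[OF _ abs_ge_self])
    then show ?thesis using that[of "\<bar>r\<bar>"] by simp
  qed
  let ?M = "lebesgue_on \<Omega>"
  have "\<exists>C\<^sub>f\<ge>0. \<forall>\<alpha> t u G. 0 < \<alpha> \<and> \<alpha> < 1 \<and> mesh_ok t \<and> L21sigma_solution \<Omega> \<alpha> f t u G \<longrightarrow>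
        (\<forall>n\<ge>1. L2vec_norm \<Omega> (G n) \<le> L2vec_norm \<Omega> (G 0) + 2 * C\<^sub>f * (2 * R))"
    if src: "source_ok \<Omega> f" for f
  proof -
    have f2: "L2 \<Omega> (f s)" if "0 \<le> s" for s using src that by (simp add: source_ok_def)
    obtain B where B: "\<And>s. 0 \<le> s \<Longrightarrow> L2norm \<Omega> (f s) \<le> B"
      using src by (auto simp: source_ok_def)
    obtain V where V: "\<And>m (s::nat \<Rightarrow> real). 0 \<le> s 0 \<Longrightarrow> (\<And>i. i < m \<Longrightarrow> s i \<le> s (Suc i)) \<Longrightarrow>
        (\<Sum>i<m. L2norm \<Omega> (\<lambda>x. f (s (Suc i)) x - f (s i) x)) \<le> V"
      using src unfolding source_ok_def by blast
    have B0: "0 \<le> B" using B[of 0] sq_norm_nonneg[of ?M "f 0"] by (simp add: L2norm_eq)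
    have V0: "0 \<le> V" using V[of "\<lambda>_. 0" 0] by simp
    have "L2vec_norm \<Omega> (G n) \<le> L2vec_norm \<Omega> (G 0) + 2 * (2 * B + V) * (2 * R)"
      if \<alpha>: "0 < \<alpha>" "\<alpha> < 1" and mesh: "mesh_ok t" and sol: "L21sigma_solution \<Omega> \<alpha> f t u G"
      for \<alpha> t u G n
    proof -
      define N where "N k = L2vec_norm \<Omega> (G k)" for k
      have N0: "0 \<le> N k" for k by (simp add: N_def L2vec_norm_eq sq_norm_nonneg)
      define s where "s k = tstar (1 - \<alpha> / 2) t k" for k
      have s_nonneg: "0 \<le> s k" if "1 \<le> k" for k
        using tstar_bounds(1)[OF mesh that, of "1 - \<alpha> / 2"] t_mono[OF mesh, of 0 "k - 1"] mesh \<alpha>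
        by (auto simp: s_def mesh_ok_def)
      have s_mono: "s k \<le> s (Suc k)" if "1 \<le> k" for k
        using tstar_bounds(3)[OF mesh that, of "1 - \<alpha> / 2"] \<alpha> by (simp add: s_def)
      have u: "L2norm \<Omega> (u k) \<le> 2 * R * N k" "sq_integrable ?M (u k)" for k
        using Poincare[OF \<Omega>(1) R(2,1)] sol
        by (auto simp: L21sigma_solution_def N_def L2_iff H01_def)
      obtain m where m: "m \<le> n" "\<And>k. k \<le> n \<Longrightarrow> N k \<le> N m"
      proof -
        have "Max (N ` {..n}) \<in> N ` {..n}" by (intro Max_in) auto
        then obtain m where m: "Max (N ` {..n}) = N m" "m \<in> {..n}" by (rule imageE)
        have "N k \<le> N m" if "k \<le> n" for k
          unfolding m(1)[symmetric] using that by (intro Max_ge) auto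
        then show ?thesis using that m(2) by auto
      qed
      have "N m \<le> N 0 + 2 * (2 * B + V) * (2 * R)"
      proof (cases "m = 0")
        case True
        then show ?thesis using B0 V0 R by simp
      next
        case False
        \<comment> \<open>\<open>F 0\<close> does not enter the sums; giving it the first sampling
          time extends the bounds, which are established from \<open>s 1\<close> on, to every
          index.\<close>
        define F where "F k = f (s (if k = 0 then 1 else k))" for k
        have F: "sq_integrable ?M (F k)" "sq_norm ?M (F k) \<le> B" for k
          using f2 B s_nonneg by (auto simp: F_def L2_iff[symmetric] L2norm_eq[symmetric])
        have "(\<Sum>i<m - 1. L2norm \<Omega> (\<lambda>x. f (s (Suc (Suc i))) x - f (s (Suc i)) x)) \<le> V"
          using V[of "\<lambda>i. s (Suc i)" "m - 1"] s_nonneg s_mono by simp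
        also have "(\<Sum>i<m - 1. L2norm \<Omega> (\<lambda>x. f (s (Suc (Suc i))) x - f (s (Suc i)) x))
            = (\<Sum>k=1..<m. sq_norm ?M (\<lambda>x. F (Suc k) x - F k x))"
          by (rule sum.reindex_bij_witness[of _ "\<lambda>k. k - 1" Suc]) (auto simp: F_def L2norm_eq)
        finally have FV: "(\<Sum>k=1..<m. sq_norm ?M (\<lambda>x. F (Suc k) x - F k x)) \<le> V" .
        have uU: "sq_norm ?M (u k) \<le> 2 * R * N m" if "k \<le> m" for k
        proof -
          have "2 * R * N k \<le> 2 * R * N m" using m that R by (intro mult_left_mono) auto
          then show ?thesis using u(1)[of k] by (simp add: L2norm_eq)
        qed
        have "(N m)\<^sup>2 \<le> (N 0)\<^sup>2 + 2 * (\<Sum>k=1..m. integral\<^sup>L ?M (\<lambda>x. f (s k) x * (u k x - u (k - 1) x)))"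
          unfolding N_def s_def by (rule L21sigma_energy_bound[OF \<Omega> \<alpha> mesh f2 sol])
        also have "(\<Sum>k=1..m. integral\<^sup>L ?M (\<lambda>x. f (s k) x * (u k x - u (k - 1) x)))
            = (\<Sum>k=1..m. integral\<^sup>L ?M (\<lambda>x. F k x * (u k x - u (k - 1) x)))"
          by (rule sum.cong) (auto simp: F_def)
        also have "\<dots> \<le> (2 * B + V) * (2 * R * N m)"
          using source_sum_bound[OF F(1) u(2) F(2) uU FV] False by simp
        finally have "(N m)\<^sup>2 \<le> (N 0)\<^sup>2 + 2 * ((2 * B + V) * (2 * R * N m))" by simp
        \<comment> \<open>Maximality of \<open>N m\<close> makes the initial energy divisible by
          \<open>N m\<close> as well, so that \<open>N 0\<close> survives the cancellation with
          coefficient 1.\<close>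
        moreover have "(N 0)\<^sup>2 \<le> N 0 * N m"
          using m(2)[of 0] N0 by (simp add: power2_eq_square mult_left_mono)
        ultimately have "N m * N m \<le> N m * (N 0 + 2 * (2 * B + V) * (2 * R))"
          by (simp add: power2_eq_square algebra_simps)
        moreover have "0 \<le> N 0 + 2 * (2 * B + V) * (2 * R)" using N0 B0 V0 R by simp
        ultimately show ?thesis using N0[of m] by (cases "N m = 0") auto
      qed
      then show ?thesis using m(2)[of n] by (simp add: N_def)
    qed
    \<comment> \<open>The witness depends on \<open>f\<close> alone: twice the uniform bound for the
      boundary terms, plus the variation bound.\<close>
    then show ?thesis using B0 V0 by (intro exI[of _ "2 * B + V"]) auto
  qed
  then show ?thesis using R by (intro exI[of _ "2 * R"]) auto
qed

end
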